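(* Let $m, n \in \mathbb{N}$ with $m \geq 3$, $n \geq 2$, and let $K$ be a field containing a primitive $m$-th root of unity $q$. There exists a bijective correspondence between the set of all matched pairs of Hopf algebras $(T_{m^{2}}(q), K[C_n], \triangleleft, \triangleright)$ and the group $U_n(K)$ of $n$-th roots of unity in $K$. More precisely, the matched pair $(\triangleleft, \triangleright)$ corresponding to an $n$-th root of unity $\omega \in U_n(K)$ is given by $$g^{i} \triangleright h^{j} x^{k} = \omega^{ik} h^{j} x^{k}, \qquad g^{i} \triangleleft h^{j} x^{k} = g^{i}\, \varepsilon(x^{k})$$ for all $i = 0,\dots,n-1$ and $j,k = 0,\dots,m-1$.
   Context: All algebras, coalgebras, Hopf algebras, tensor products and linear maps are over the field $K$; Sweedler notation $\Delta(c)=c_{(1)}\otimes c_{(2)}$ is used. $U_n(K)=\{\omega\in K \mid \omega^n=1\}$. A primitive $m$-th root of unity is a generator of $U_m(K)$ when $|U_m(K)|=m$. $C_n$ is the cyclic group of order $n$ generated by $g$, and $K[C_n]$ is its group Hopf algebra ($g$ is group-like). Taft algebra: $T_{m^2}(q)$ is the Hopf algebra generated as an algebra by $h$ and $x$ subject to $h^m=1$, $x^m=0$, $xh=qhx$, with $\Delta(h)=h\otimes h$, $\Delta(x)=x\otimes h+1\otimes x$, $\varepsilon(h)=1$, $\varepsilon(x)=0$, $S(h)=h^{-1}$, $S(x)=-xh^{-1}$. It has $K$-basis $\{h^ix^j\}_{0\le i,j\le m-1}$. Matched pair: a matched pair of Hopf algebras is a quadruple $(A,H,\triangleleft,\triangleright)$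 where $A$, $H$ are Hopf algebras and $\triangleleft\colon H\otimes A\to H$, $\triangleright\colon H\otimes A\to A$ are coalgebra maps such that $(A,\triangleright)$ is a left $H$-module (hence a left $H$-module coalgebra), $(H,\triangleleft)$ is a right $A$-module (hence a right $A$-module coalgebra), and for all $a,b\in A$, $y,z\in H$: (1) $y\triangleright 1_A=\varepsilon_H(y)1_A$ and $1_H\triangleleft a=\varepsilon_A(a)1_H$; (2) $y\triangleright(ab)=(y_{(1)}\triangleright a_{(1)})\big((y_{(2)}\triangleleft a_{(2)})\triangleright b\big)$; (3) $(yz)\triangleleft a=\big(y\triangleleft(z_{(1)}\triangleright a_{(1)})\big)(z_{(2)}\triangleleft a_{(2)})$; (4) $y_{(1)}\triangleleft a_{(1)}\otimes y_{(2)}\triangleright a_{(2)}=y_{(2)}\triangleleft a_{(2)}\otimes y_{(1)}\triangleright a_{(1)}$. *)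

theory Defs
  imports Complex_Main "HOL-Library.Poly_Mapping" "HOL-Algebra.Generated_Groups"
begin

section \<open>Vector spaces and tensor products\<close>

text \<open>
  A vector space over the field \<open>'k\<close> is presented as the space \<open>'i \<Rightarrow>\<^sub>0 'k\<close> of finitely
  supported functions on an arbitrary index type \<open>'i\<close>. Every vector space has this form once a
  basis is chosen, and the choice is immaterial below: nothing relates the unit vectors of a Hopf
  algebra to its structure maps. The benefit is that the tensor product is again a type of the
  same form, \<open>('i \<Rightarrow>\<^sub>0 'k) \<otimes> ('j \<Rightarrow>\<^sub>0 'k) = ('i \<times> 'j \<Rightarrow>\<^sub>0 'k)\<close>, so that structure maps are
  literally linear maps between tensor products.

  The convolution product that the library puts on \<open>'i \<Rightarrow>\<^sub>0 'k\<close> for a monoid \<open>'i\<close> plays no role.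
\<close>

definition scal :: "'k::field \<Rightarrow> ('i \<Rightarrow>\<^sub>0 'k) \<Rightarrow> ('i \<Rightarrow>\<^sub>0 'k)"
  where "scal c v = Poly_Mapping.map ((*) c) v"

lemma lookup_scal [simp]: "Poly_Mapping.lookup (scal c v) i = c * Poly_Mapping.lookup v i"
  unfolding scal_def by (transfer) (simp add: when_def)

lemma vector_space_scal: "vector_space scal"
  by unfold_locales (auto intro!: poly_mapping_eqI simp: Poly_Mapping.lookup_add algebra_simps)

interpretation kvec: vector_space scal
  by (rule vector_space_scal)

abbreviation klinear :: "(('i \<Rightarrow>\<^sub>0 'k::field) \<Rightarrow> ('j \<Rightarrow>\<^sub>0 'k)) \<Rightarrow> bool"
  where "klinear \<equiv> Vector_Spaces.linear scal scal"

abbreviation klinear_form :: "(('i \<Rightarrow>\<^sub>0 'k::field) \<Rightarrow> 'k) \<Rightarrow> bool"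
  where "klinear_form \<equiv> Vector_Spaces.linear scal (*)"

definition unit_vec :: "'i \<Rightarrow> ('i \<Rightarrow>\<^sub>0 'k::field)"
  where "unit_vec i = Poly_Mapping.single i 1"

definition tensor :: "('i \<Rightarrow>\<^sub>0 'k::field) \<Rightarrow> ('j \<Rightarrow>\<^sub>0 'k) \<Rightarrow> ('i \<times> 'j \<Rightarrow>\<^sub>0 'k)"  (infixr "\<otimes>\<^sub>K" 75)
  where "v \<otimes>\<^sub>K w =
    (\<Sum>i\<in>Poly_Mapping.keys v. \<Sum>j\<in>Poly_Mapping.keys w.
       Poly_Mapping.single (i, j) (Poly_Mapping.lookup v i * Poly_Mapping.lookup w j))"

text \<open>
  For bilinear \<open>\<beta>\<close>, \<open>tlift \<beta>\<close> is the linear map on the tensor product with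
  \<open>v \<otimes> w \<mapsto> \<beta> v w\<close> (lemma \<open>tlift_tensor\<close>). It renders Sweedler notation:
  \<open>tlift (\<lambda>c1 c2. \<beta> c1 c2) (\<Delta> c)\<close> stands for the Sweedler sum of \<open>\<beta> c1 c2\<close>.
\<close>

definition tlift ::
  "(('i \<Rightarrow>\<^sub>0 'k::field) \<Rightarrow> ('j \<Rightarrow>\<^sub>0 'k) \<Rightarrow> ('l \<Rightarrow>\<^sub>0 'k)) \<Rightarrow> ('i \<times> 'j \<Rightarrow>\<^sub>0 'k) \<Rightarrow> ('l \<Rightarrow>\<^sub>0 'k)"
  where "tlift \<beta> t = (\<Sum>p\<in>Poly_Mapping.keys t.
       scal (Poly_Mapping.lookup t p) (\<beta> (unit_vec (fst p)) (unit_vec (snd p))))"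

definition tlift_form ::
  "(('i \<Rightarrow>\<^sub>0 'k::field) \<Rightarrow> ('j \<Rightarrow>\<^sub>0 'k) \<Rightarrow> 'k) \<Rightarrow> ('i \<times> 'j \<Rightarrow>\<^sub>0 'k) \<Rightarrow> 'k"
  where "tlift_form \<beta> t = (\<Sum>p\<in>Poly_Mapping.keys t.
       Poly_Mapping.lookup t p * \<beta> (unit_vec (fst p)) (unit_vec (snd p)))"

lemma lookup_tensor: "Poly_Mapping.lookup (v \<otimes>\<^sub>K w) (i, j) =
    Poly_Mapping.lookup v i * Poly_Mapping.lookup w j"
proof -
  have inner: "(\<Sum>b\<in>Poly_Mapping.keys w.
        Poly_Mapping.lookup (Poly_Mapping.single (a, b)
          (Poly_Mapping.lookup v a * Poly_Mapping.lookup w b)) (i, j))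
      = (if a = i then Poly_Mapping.lookup v a * Poly_Mapping.lookup w j else 0)" for a
    by (auto simp: Poly_Mapping.lookup_single when_def if_distrib sum.delta
           Poly_Mapping.in_keys_iff cong: if_cong)
  show ?thesis
    unfolding tensor_def
    by (simp add: Poly_Mapping.lookup_sum inner sum.delta Poly_Mapping.in_keys_iff)
qed

lemma unit_vec_expansion: "v = (\<Sum>i\<in>Poly_Mapping.keys v. scal (Poly_Mapping.lookup v i) (unit_vec i))"
  by (rule poly_mapping_eqI)
     (auto simp: Poly_Mapping.lookup_sum unit_vec_def Poly_Mapping.lookup_single when_def if_distrib sum.delta
           Poly_Mapping.in_keys_iff
           cong: if_cong)

lemma tlift_tensor:
  fixes \<beta> :: "('i \<Rightarrow>\<^sub>0 'k::field) \<Rightarrow> ('j \<Rightarrow>\<^sub>0 'k) \<Rightarrow> ('l \<Rightarrow>\<^sub>0 'k)"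
  assumes "\<And>w. klinear (\<lambda>v. \<beta> v w)" and "\<And>v. klinear (\<beta> v)"
  shows "tlift \<beta> (v \<otimes>\<^sub>K w) = \<beta> v w"
proof -
  interpret l1: Vector_Spaces.linear scal scal "\<lambda>v. \<beta> v b" for b by (rule assms(1))
  interpret l2: Vector_Spaces.linear scal scal "\<beta> a" for a by (rule assms(2))
  have keys_tensor: "Poly_Mapping.keys (v \<otimes>\<^sub>K w) = Poly_Mapping.keys v \<times> Poly_Mapping.keys w"
    by (auto simp: Poly_Mapping.in_keys_iff lookup_tensor)
  have "\<beta> v w = (\<Sum>i\<in>Poly_Mapping.keys v. scal (Poly_Mapping.lookup v i) (\<beta> (unit_vec i) w))"
    by (subst (1) unit_vec_expansion[of v]) (simp add: l1.sum l1.scale)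
  also have "\<dots> = (\<Sum>i\<in>Poly_Mapping.keys v. scal (Poly_Mapping.lookup v i)
      (\<Sum>j\<in>Poly_Mapping.keys w. scal (Poly_Mapping.lookup w j) (\<beta> (unit_vec i) (unit_vec j))))"
    by (intro sum.cong refl arg_cong[where f = "scal _"], subst (1) unit_vec_expansion[of w])
       (simp add: l2.sum l2.scale)
  also have "\<dots> = tlift \<beta> (v \<otimes>\<^sub>K w)"
    by (simp add: tlift_def keys_tensor sum.cartesian_product' lookup_tensor kvec.scale_sum_right)
  finally show ?thesis by (rule sym)
qed


section \<open>Coalgebras, algebras, Hopf algebras\<close>

record (overloaded) ('i, 'k::zero) coalg =
  comult :: "('i \<Rightarrow>\<^sub>0 'k) \<Rightarrow> ('i \<times> 'i \<Rightarrow>\<^sub>0 'k)"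
  counit :: "('i \<Rightarrow>\<^sub>0 'k) \<Rightarrow> 'k"

record (overloaded) ('i, 'k::zero) hopf = "('i, 'k) coalg" +
  hmult :: "('i \<times> 'i \<Rightarrow>\<^sub>0 'k) \<Rightarrow> ('i \<Rightarrow>\<^sub>0 'k)"
  hone :: "'i \<Rightarrow>\<^sub>0 'k"
  antipode :: "('i \<Rightarrow>\<^sub>0 'k) \<Rightarrow> ('i \<Rightarrow>\<^sub>0 'k)"

definition coalgebra :: "('i, 'k::field, 'z) coalg_scheme \<Rightarrow> bool"
  where "coalgebra C \<longleftrightarrow>
    klinear (comult C) \<and> klinear_form (counit C) \<and>
    (\<forall>c. tlift (\<lambda>c1 c2. tlift (\<lambda>c11 c12. c11 \<otimes>\<^sub>K c12 \<otimes>\<^sub>K c2) (comult C c1)) (comult C c)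
       = tlift (\<lambda>c1 c2. c1 \<otimes>\<^sub>K comult C c2) (comult C c)) \<and>
    (\<forall>c. tlift (\<lambda>c1 c2. scal (counit C c1) c2) (comult C c) = c) \<and>
    (\<forall>c. tlift (\<lambda>c1 c2. scal (counit C c2) c1) (comult C c) = c)"

definition coalgebra_map ::
  "('i, 'k::field, 'z) coalg_scheme \<Rightarrow> ('j, 'k, 'y) coalg_scheme \<Rightarrow> (('i \<Rightarrow>\<^sub>0 'k) \<Rightarrow> ('j \<Rightarrow>\<^sub>0 'k)) \<Rightarrow> bool"
  where "coalgebra_map C D f \<longleftrightarrow>
    klinear f \<and>
    (\<forall>c. comult D (f c) = tlift (\<lambda>c1 c2. f c1 \<otimes>\<^sub>K f c2) (comult C c)) \<and>
    (\<forall>c. counit D (f c) = counit C c)"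

definition tensor_coalg ::
  "('i, 'k::field, 'z) coalg_scheme \<Rightarrow> ('j, 'k, 'y) coalg_scheme \<Rightarrow> ('i \<times> 'j, 'k) coalg"
  where "tensor_coalg C D =
    \<lparr> comult = tlift (\<lambda>c d. tlift (\<lambda>c1 c2. tlift (\<lambda>d1 d2. (c1 \<otimes>\<^sub>K d1) \<otimes>\<^sub>K (c2 \<otimes>\<^sub>K d2))
                 (comult D d)) (comult C c)),
      counit = tlift_form (\<lambda>c d. counit C c * counit D d) \<rparr>"

abbreviation hmul :: "('i, 'k::field, 'z) hopf_scheme \<Rightarrow> ('i \<Rightarrow>\<^sub>0 'k) \<Rightarrow> ('i \<Rightarrow>\<^sub>0 'k) \<Rightarrow> ('i \<Rightarrow>\<^sub>0 'k)"
  where "hmul A a b \<equiv> hmult A (a \<otimes>\<^sub>K b)"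

primrec hpow :: "('i, 'k::field, 'z) hopf_scheme \<Rightarrow> ('i \<Rightarrow>\<^sub>0 'k) \<Rightarrow> nat \<Rightarrow> ('i \<Rightarrow>\<^sub>0 'k)"
  where
    "hpow A a 0 = hone A"
  | "hpow A a (Suc n) = hmul A a (hpow A a n)"

definition hinv :: "('i, 'k::field, 'z) hopf_scheme \<Rightarrow> ('i \<Rightarrow>\<^sub>0 'k) \<Rightarrow> ('i \<Rightarrow>\<^sub>0 'k)"
  where "hinv A a = (THE b. hmul A a b = hone A \<and> hmul A b a = hone A)"

definition unital_algebra :: "('i, 'k::field, 'z) hopf_scheme \<Rightarrow> bool"
  where "unital_algebra A \<longleftrightarrow>
    klinear (hmult A) \<and>
    (\<forall>a b c. hmul A (hmul A a b) c = hmul A a (hmul A b c)) \<and>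
    (\<forall>a. hmul A (hone A) a = a \<and> hmul A a (hone A) = a)"

definition bialgebra :: "('i, 'k::field, 'z) hopf_scheme \<Rightarrow> bool"
  where "bialgebra A \<longleftrightarrow>
    unital_algebra A \<and> coalgebra A \<and>
    (\<forall>a b. comult A (hmul A a b) =
       tlift (\<lambda>a1 a2. tlift (\<lambda>b1 b2. hmul A a1 b1 \<otimes>\<^sub>K hmul A a2 b2) (comult A b)) (comult A a)) \<and>
    comult A (hone A) = hone A \<otimes>\<^sub>K hone A \<and>
    (\<forall>a b. counit A (hmul A a b) = counit A a * counit A b) \<and>
    counit A (hone A) = 1"

definition hopf_algebra :: "('i, 'k::field, 'z) hopf_scheme \<Rightarrow> bool"
  where "hopf_algebra A \<longleftrightarrow>
    bialgebra A \<and> klinear (antipode A) \<and>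
    (\<forall>a. tlift (\<lambda>a1 a2. hmul A (antipode A a1) a2) (comult A a) = scal (counit A a) (hone A)) \<and>
    (\<forall>a. tlift (\<lambda>a1 a2. hmul A a1 (antipode A a2)) (comult A a) = scal (counit A a) (hone A))"


section \<open>Matched pairs of Hopf algebras\<close>

definition left_module_action ::
  "('h, 'k::field, 'z) hopf_scheme \<Rightarrow> (('h \<times> 'a \<Rightarrow>\<^sub>0 'k) \<Rightarrow> ('a \<Rightarrow>\<^sub>0 'k)) \<Rightarrow> bool"
  where "left_module_action H lact \<longleftrightarrow>
    klinear lact \<and>
    (\<forall>a. lact (hone H \<otimes>\<^sub>K a) = a) \<and>
    (\<forall>y z a. lact (hmul H y z \<otimes>\<^sub>K a) = lact (y \<otimes>\<^sub>K lact (z \<otimes>\<^sub>K a)))"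

definition right_module_action ::
  "('a, 'k::field, 'z) hopf_scheme \<Rightarrow> (('h \<times> 'a \<Rightarrow>\<^sub>0 'k) \<Rightarrow> ('h \<Rightarrow>\<^sub>0 'k)) \<Rightarrow> bool"
  where "right_module_action A ract \<longleftrightarrow>
    klinear ract \<and>
    (\<forall>y. ract (y \<otimes>\<^sub>K hone A) = y) \<and>
    (\<forall>y a b. ract (y \<otimes>\<^sub>K hmul A a b) = ract (ract (y \<otimes>\<^sub>K a) \<otimes>\<^sub>K b))"

text \<open>\<open>ract\<close> is \<open>\<triangleleft>: H \<otimes> A \<rightarrow> H\<close> and \<open>lact\<close> is \<open>\<triangleright>: H \<otimes> A \<rightarrow> A\<close>.\<close>

definition matched_pair ::
  "('a, 'k::field, 'z) hopf_scheme \<Rightarrow> ('h, 'k, 'y) hopf_scheme \<Rightarrow>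
   (('h \<times> 'a \<Rightarrow>\<^sub>0 'k) \<Rightarrow> ('h \<Rightarrow>\<^sub>0 'k)) \<Rightarrow> (('h \<times> 'a \<Rightarrow>\<^sub>0 'k) \<Rightarrow> ('a \<Rightarrow>\<^sub>0 'k)) \<Rightarrow> bool"
  where "matched_pair A H ract lact \<longleftrightarrow>
    hopf_algebra A \<and> hopf_algebra H \<and>
    coalgebra_map (tensor_coalg H A) H ract \<and>
    coalgebra_map (tensor_coalg H A) A lact \<and>
    left_module_action H lact \<and>
    right_module_action A ract \<and>
    (\<forall>y. lact (y \<otimes>\<^sub>K hone A) = scal (counit H y) (hone A)) \<and>
    (\<forall>a. ract (hone H \<otimes>\<^sub>K a) = scal (counit A a) (hone H)) \<and>
    (\<forall>y a b. lact (y \<otimes>\<^sub>K hmul A a b) =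
       tlift (\<lambda>y1 y2. tlift (\<lambda>a1 a2. hmul A (lact (y1 \<otimes>\<^sub>K a1)) (lact (ract (y2 \<otimes>\<^sub>K a2) \<otimes>\<^sub>K b)))
         (comult A a)) (comult H y)) \<and>
    (\<forall>y z a. ract (hmul H y z \<otimes>\<^sub>K a) =
       tlift (\<lambda>z1 z2. tlift (\<lambda>a1 a2. hmul H (ract (y \<otimes>\<^sub>K lact (z1 \<otimes>\<^sub>K a1))) (ract (z2 \<otimes>\<^sub>K a2)))
         (comult A a)) (comult H z)) \<and>
    (\<forall>y a.
       tlift (\<lambda>y1 y2. tlift (\<lambda>a1 a2. ract (y1 \<otimes>\<^sub>K a1) \<otimes>\<^sub>K lact (y2 \<otimes>\<^sub>K a2))
         (comult A a)) (comult H y)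
     = tlift (\<lambda>y1 y2. tlift (\<lambda>a1 a2. ract (y2 \<otimes>\<^sub>K a2) \<otimes>\<^sub>K lact (y1 \<otimes>\<^sub>K a1))
         (comult A a)) (comult H y))"


section \<open>Algebras given by generators and relations\<close>

text \<open>
  The free algebra on a type \<open>'s\<close> of symbols is \<open>'s list \<Rightarrow>\<^sub>0 'k\<close>, with basis the words and
  multiplication given by concatenation.
\<close>

definition free_eval ::
  "('i, 'k::field, 'z) hopf_scheme \<Rightarrow> ('s \<Rightarrow> ('i \<Rightarrow>\<^sub>0 'k)) \<Rightarrow> ('s list \<Rightarrow>\<^sub>0 'k) \<Rightarrow> ('i \<Rightarrow>\<^sub>0 'k)"
  where "free_eval A \<gamma> p =
    (\<Sum>w\<in>Poly_Mapping.keys p. scal (Poly_Mapping.lookup p w) (foldr (\<lambda>s a. hmul A (\<gamma> s) a) w (hone A)))"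

definition word_mult :: "'s list \<Rightarrow> ('s list \<Rightarrow>\<^sub>0 'k::field) \<Rightarrow> 's list \<Rightarrow> ('s list \<Rightarrow>\<^sub>0 'k)"
  where "word_mult u r v = (\<Sum>w\<in>Poly_Mapping.keys r. scal (Poly_Mapping.lookup r w) (unit_vec (u @ w @ v)))"

definition free_ideal :: "('s list \<Rightarrow>\<^sub>0 'k::field) set \<Rightarrow> ('s list \<Rightarrow>\<^sub>0 'k) set"
  where "free_ideal R = kvec.span {word_mult u r v | u r v. r \<in> R}"

definition presented_by ::
  "('i, 'k::field, 'z) hopf_scheme \<Rightarrow> ('s \<Rightarrow> ('i \<Rightarrow>\<^sub>0 'k)) \<Rightarrow> ('s list \<Rightarrow>\<^sub>0 'k) set \<Rightarrow> bool"
  where "presented_by A \<gamma> R \<longleftrightarrow>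
    unital_algebra A \<and> surj (free_eval A \<gamma>) \<and> {p. free_eval A \<gamma> p = 0} = free_ideal R"


section \<open>Taft algebras and group Hopf algebras\<close>

definition roots_of_unity :: "nat \<Rightarrow> 'k::field set"
  where "roots_of_unity n = {\<omega>. \<omega> ^ n = 1}"

definition primitive_root_of_unity :: "nat \<Rightarrow> 'k::field \<Rightarrow> bool"
  where "primitive_root_of_unity m q \<longleftrightarrow>
    card (roots_of_unity m :: 'k set) = m \<and> roots_of_unity m = {q powi i | i :: int. True}"

datatype taft_symbol = Sym_h | Sym_x

definition taft_relations :: "nat \<Rightarrow> 'k::field \<Rightarrow> (taft_symbol list \<Rightarrow>\<^sub>0 'k) set"
  where "taft_relations m q =
    {unit_vec (replicate m Sym_h) - unit_vec [],
     unit_vec (replicate m Sym_x),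
     unit_vec [Sym_x, Sym_h] - scal q (unit_vec [Sym_h, Sym_x])}"

definition taft_algebra ::
  "nat \<Rightarrow> 'k::field \<Rightarrow> ('t, 'k, 'z) hopf_scheme \<Rightarrow> ('t \<Rightarrow>\<^sub>0 'k) \<Rightarrow> ('t \<Rightarrow>\<^sub>0 'k) \<Rightarrow> bool"
  where "taft_algebra m q T h x \<longleftrightarrow>
    hopf_algebra T \<and>
    presented_by T (case_taft_symbol h x) (taft_relations m q) \<and>
    comult T h = h \<otimes>\<^sub>K h \<and>
    comult T x = x \<otimes>\<^sub>K h + hone T \<otimes>\<^sub>K x \<and>
    counit T h = 1 \<and> counit T x = 0 \<and>
    antipode T h = hinv T h \<and>
    antipode T x = - hmul T x (hinv T h)"

text \<open>\<open>u\<close> embeds the group \<open>G\<close> into its group Hopf algebra.\<close>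

definition group_hopf_algebra ::
  "('g, 'w) monoid_scheme \<Rightarrow> ('c, 'k::field, 'z) hopf_scheme \<Rightarrow> ('g \<Rightarrow> ('c \<Rightarrow>\<^sub>0 'k)) \<Rightarrow> bool"
  where "group_hopf_algebra G H u \<longleftrightarrow>
    group G \<and> hopf_algebra H \<and>
    inj_on u (carrier G) \<and>
    kvec.independent (u ` carrier G) \<and> kvec.span (u ` carrier G) = UNIV \<and>
    (\<forall>a\<in>carrier G. \<forall>b\<in>carrier G. hmul H (u a) (u b) = u (a \<otimes>\<^bsub>G\<^esub> b)) \<and>
    hone H = u \<one>\<^bsub>G\<^esub> \<and>
    (\<forall>a\<in>carrier G. comult H (u a) = u a \<otimes>\<^sub>K u a \<and> counit H (u a) = 1 \<and>
       antipode H (u a) = u (inv\<^bsub>G\<^esub> a))"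

end

theory Submission
  imports Defs "HOL-Algebra.Multiplicative_Group"
begin

text \<open>
  Write \<open>T\<close> for the Taft algebra, and let \<open>a\<close> be an element of the cyclic group.

  Suppose a matched pair is given. Since \<open>a\<close> is group-like, \<open>z \<mapsto> a \<triangleright> z\<close> is a coalgebra map of \<open>T\<close>, and it
  is injective because \<open>a\<close> is invertible. The compatibility axiom between the two actions, written out at
  \<open>a\<close> and \<open>x\<close>, says \<open>(a \<triangleleft> h - a) \<otimes> (a \<triangleright> x) = (a \<triangleleft> x) \<otimes> (a \<triangleright> h - 1)\<close>. If \<open>a \<triangleleft> h\<close> differed from \<open>a\<close>,
  then \<open>a \<triangleright> x\<close> would be a multiple of \<open>a \<triangleright> (h - 1)\<close>, and \<open>x\<close> a multiple of \<open>h - 1\<close>, which is impossible.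
  Hence \<open>a \<triangleleft> h = a\<close>, then \<open>a \<triangleleft> x = 0\<close>, and the right action is trivial. For a trivial right action the
  axiom on \<open>y \<triangleright> (z w)\<close> makes \<open>a \<triangleright> -\<close> multiplicative, so \<open>a\<close> acts by an injective bialgebra
  endomorphism of \<open>T\<close> (\<open>matched_pair_form\<close>).

  Such an endomorphism \<open>\<phi>\<close> fixes \<open>h\<close> and multiplies \<open>x\<close> by a scalar (\<open>bialgebra_endo_form\<close>). First,
  \<open>\<phi> h\<close> is group-like, and a group-like element \<open>k\<close> of \<open>T\<close> is a power of \<open>h\<close>: comultiplication preserves the
  degree in \<open>x\<close>, so \<open>\<Delta> k\<close> has no component of degree above the top degree \<open>d\<close> of \<open>k\<close>, while \<open>k \<otimes> k\<close> has
  one of degree \<open>2 d\<close>; thus \<open>d = 0\<close> (\<open>grouplike_eq_h_power\<close>). Let \<open>\<phi> h = h\<^sup>s\<close> and \<open>y = \<phi> x\<close>. Then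
  \<open>y h\<^sup>s = q h\<^sup>s y\<close> forces \<open>q\<^sup>s\<^sup>j = q\<close> for each monomial of degree \<open>j\<close> in \<open>y\<close>. This excludes \<open>j = 0\<close>. If
  only degrees \<open>j \<ge> 2\<close> occurred, then \<open>y\<close> to the power \<open>m - 1\<close> would vanish for degree reasons, although
  \<open>x\<close> to the power \<open>m - 1\<close> does not. So degree 1 occurs, \<open>q\<^sup>s = q\<close>, whence \<open>\<phi> h = h\<close> and \<open>y = p(h) x\<close>; comparing
  \<open>\<Delta> y\<close> with \<open>y \<otimes> h + 1 \<otimes> y\<close> leaves only the constant term of \<open>p\<close>.

  Consequently a matched pair is determined by the scalar \<open>\<omega>\<close> by which the generator \<open>c\<close> of the group
  rescales \<open>x\<close>, and \<open>\<omega>\<^sup>n = 1\<close> because \<open>c\<^sup>n = 1\<close>. Conversely, rescaling \<open>x\<close> by \<open>\<omega>\<close> is a bialgebra endomorphism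
  of \<open>T\<close>; for \<open>\<omega>\<^sup>n = 1\<close> the powers of this endomorphism give an action of the cyclic group, and any action
  of a group by bialgebra endomorphisms forms a matched pair with the trivial right action
  (\<open>matched_pair_trivial_right\<close>).

  The arguments with coefficients rest on the linear independence of the monomials \<open>h\<^sup>i x\<^sup>j\<close>, \<open>i, j < m\<close>.
  It is obtained from the presentation by letting \<open>T\<close> act on a vector space with basis
  \<open>e(i, j)\<close> so that \<open>h\<^sup>i x\<^sup>j\<close> sends \<open>e(0, 0)\<close> to \<open>e(i, j)\<close> (\<open>ex_coordinates\<close>).
\<close>

section \<open>Linear maps out of tensor products\<close>

lemma klinear_iff:
  "klinear f \<longleftrightarrow> (\<forall>v w. f (v + w) = f v + f w) \<and> (\<forall>c v. f (scal c v) = scal c (f v))"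
  by (simp add: Vector_Spaces.linear_iff vector_space_scal)

lemma klinear_form_iff:
  fixes f :: "('i \<Rightarrow>\<^sub>0 'k::field) \<Rightarrow> 'k"
  shows "klinear_form f \<longleftrightarrow> (\<forall>v w. f (v + w) = f v + f w) \<and> (\<forall>c v. f (scal c v) = c * f v)"
proof -
  have "vector_space ((*) :: 'k \<Rightarrow> 'k \<Rightarrow> 'k)"
    by unfold_locales (auto simp: algebra_simps)
  then show ?thesis
    by (simp add: Vector_Spaces.linear_iff vector_space_scal)
qed

lemma klinear_zero: "klinear f \<Longrightarrow> f 0 = 0"
  by (metis klinear_iff kvec.scale_zero_left)

lemma klinear_diff: "klinear f \<Longrightarrow> f (v - w) = f v - f w"
  by (metis klinear_iff diff_eq_eq)

lemma klinear_sum: "klinear f \<Longrightarrow> f (sum F A) = (\<Sum>a\<in>A. f (F a))"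
  by (induction A rule: infinite_finite_induct) (simp_all add: klinear_zero klinear_iff)

lemma klinear_ident: "klinear (\<lambda>v. v)"
  by (simp add: klinear_iff)

lemma klinear_const_zero: "klinear (\<lambda>v. 0)"
  by (simp add: klinear_iff)

lemma klinear_comp: "klinear f \<Longrightarrow> klinear g \<Longrightarrow> klinear (\<lambda>v. f (g v))"
  by (simp add: klinear_iff)

lemma klinear_plus: "klinear f \<Longrightarrow> klinear g \<Longrightarrow> klinear (\<lambda>v. f v + g v)"
  by (simp add: klinear_iff kvec.scale_right_distrib)

lemma klinear_scal: "klinear f \<Longrightarrow> klinear (\<lambda>v. scal c (f v))"
  by (simp add: klinear_iff kvec.scale_right_distrib mult.commute)

lemma klinear_sum_fun: "(\<And>a. a \<in> A \<Longrightarrow> klinear (f a)) \<Longrightarrow> klinear (\<lambda>v. \<Sum>a\<in>A. f a v)"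
  by (induction A rule: infinite_finite_induct) (auto intro: klinear_plus klinear_const_zero)

lemma klinear_scal_form: "klinear_form \<epsilon> \<Longrightarrow> klinear f \<Longrightarrow> klinear (\<lambda>v. scal (\<epsilon> (f v)) w)"
  by (simp add: klinear_iff klinear_form_iff kvec.scale_left_distrib)

lemma klinear_lookup: "klinear f \<Longrightarrow> klinear (\<lambda>v. scal (Poly_Mapping.lookup (f v) i) w)"
  by (simp add: klinear_iff Poly_Mapping.lookup_add kvec.scale_left_distrib)

lemma tensor_add_left: "(v + v') \<otimes>\<^sub>K w = v \<otimes>\<^sub>K w + v' \<otimes>\<^sub>K w"
  by (rule poly_mapping_eqI) (auto simp: lookup_tensor Poly_Mapping.lookup_add algebra_simps)

lemma tensor_add_right: "w \<otimes>\<^sub>K (v + v') = w \<otimes>\<^sub>K v + w \<otimes>\<^sub>K v'"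
  by (rule poly_mapping_eqI) (auto simp: lookup_tensor Poly_Mapping.lookup_add algebra_simps)

lemma tensor_scal_left: "scal c v \<otimes>\<^sub>K w = scal c (v \<otimes>\<^sub>K w)"
  by (rule poly_mapping_eqI) (auto simp: lookup_tensor)

lemma tensor_scal_right: "w \<otimes>\<^sub>K scal c v = scal c (w \<otimes>\<^sub>K v)"
  by (rule poly_mapping_eqI) (auto simp: lookup_tensor)

lemma klinear_tensor_left: "klinear f \<Longrightarrow> klinear (\<lambda>v. f v \<otimes>\<^sub>K w)"
  by (simp add: klinear_iff tensor_add_left tensor_scal_left)

lemma klinear_tensor_right: "klinear f \<Longrightarrow> klinear (\<lambda>v. w \<otimes>\<^sub>K f v)"
  by (simp add: klinear_iff tensor_add_right tensor_scal_right)

lemma tensor_zero_left [simp]: "0 \<otimes>\<^sub>K w = 0" and tensor_zero_right [simp]: "w \<otimes>\<^sub>K 0 = 0"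
  by (rule poly_mapping_eqI, auto simp: lookup_tensor)+

lemma tensor_diff_left: "(v - v') \<otimes>\<^sub>K w = v \<otimes>\<^sub>K w - v' \<otimes>\<^sub>K w"
  by (rule poly_mapping_eqI) (auto simp: lookup_tensor Poly_Mapping.lookup_minus algebra_simps)

lemma tensor_diff_right: "w \<otimes>\<^sub>K (v - v') = w \<otimes>\<^sub>K v - w \<otimes>\<^sub>K v'"
  by (rule poly_mapping_eqI) (auto simp: lookup_tensor Poly_Mapping.lookup_minus algebra_simps)

lemma lookup_unit_vec: "Poly_Mapping.lookup (unit_vec i) j = (if i = j then 1 else 0)"
  by (simp add: unit_vec_def Poly_Mapping.lookup_single when_def)

lemma unit_vec_tensor: "unit_vec i \<otimes>\<^sub>K unit_vec j = unit_vec (i, j)"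
  by (rule poly_mapping_eqI) (auto simp: lookup_tensor lookup_unit_vec split: if_splits)

definition linear_extension :: "('i \<Rightarrow> ('j \<Rightarrow>\<^sub>0 'k::field)) \<Rightarrow> ('i \<Rightarrow>\<^sub>0 'k) \<Rightarrow> ('j \<Rightarrow>\<^sub>0 'k)"
  where "linear_extension f v =
    (\<Sum>i\<in>Poly_Mapping.keys v. scal (Poly_Mapping.lookup v i) (f i))"

lemma linear_extension_superset:
  assumes "finite A" "Poly_Mapping.keys v \<subseteq> A"
  shows "linear_extension f v = (\<Sum>i\<in>A. scal (Poly_Mapping.lookup v i) (f i))"
  unfolding linear_extension_def
  by (rule sum.mono_neutral_left) (use assms in \<open>auto simp: Poly_Mapping.in_keys_iff\<close>)

lemma klinear_linear_extension:
  fixes f :: "'i \<Rightarrow> ('j \<Rightarrow>\<^sub>0 'k::field)"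
  shows "klinear (linear_extension f)"
  unfolding klinear_iff
proof safe
  fix v w :: "'i \<Rightarrow>\<^sub>0 'k"
  let ?A = "Poly_Mapping.keys v \<union> Poly_Mapping.keys w"
  have "Poly_Mapping.keys (v + w) \<subseteq> ?A"
    by (rule Poly_Mapping.keys_add)
  then show "linear_extension f (v + w) = linear_extension f v + linear_extension f w"
    by (simp add: linear_extension_superset[of ?A] Poly_Mapping.lookup_add
        kvec.scale_left_distrib sum.distrib)
next
  fix c :: 'k and v :: "'i \<Rightarrow>\<^sub>0 'k"
  have "Poly_Mapping.keys (scal c v) \<subseteq> Poly_Mapping.keys v"
    by (auto simp: Poly_Mapping.in_keys_iff)
  then show "linear_extension f (scal c v) = scal c (linear_extension f v)"
    by (simp add: linear_extension_superset[of "Poly_Mapping.keys v"] kvec.scale_sum_right)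
qed

lemma linear_extension_unit_vec [simp]: "linear_extension f (unit_vec i) = f i"
  by (simp add: linear_extension_superset[of "{i}"] lookup_unit_vec unit_vec_def)

lemma klinear_eq_on_unit_vecs:
  assumes "klinear f" "klinear f'" "\<And>i. f (unit_vec i) = f' (unit_vec i)"
  shows "f v = f' v"
proof -
  have "f v = (\<Sum>i\<in>Poly_Mapping.keys v. scal (Poly_Mapping.lookup v i) (f' (unit_vec i)))"
    by (subst unit_vec_expansion[of v]) (use assms in \<open>simp add: klinear_sum klinear_iff\<close>)
  also have "\<dots> = f' v"
    by (subst (3) unit_vec_expansion[of v]) (use assms in \<open>simp add: klinear_sum klinear_iff\<close>)
  finally show ?thesis .
qed

lemma tlift_eq_linear_extension:
  "tlift \<beta> = linear_extension (\<lambda>p. \<beta> (unit_vec (fst p)) (unit_vec (snd p)))"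
  by (simp add: fun_eq_iff tlift_def linear_extension_def)

lemma klinear_tlift: "klinear f \<Longrightarrow> klinear (\<lambda>v. tlift \<beta> (f v))"
  unfolding tlift_eq_linear_extension by (rule klinear_comp[OF klinear_linear_extension])

text \<open>
  This rule covers a parameter in the integrand of a Sweedler sum, the preceding one a parameter in
  the element of the tensor product. Together with the rules for the other operations they let
  \<open>intro\<close> decide the linearity conditions that arise from \<open>tlift_tensor\<close>.
\<close>

lemma klinear_tlift_integrand: "(\<And>a b. klinear (\<lambda>v. \<beta> v a b)) \<Longrightarrow> klinear (\<lambda>v. tlift (\<beta> v) t)"
  unfolding tlift_def by (intro klinear_sum_fun klinear_scal) auto

lemma klinear_of_tlift: "klinear f \<Longrightarrow> f (tlift \<beta> t) = tlift (\<lambda>a b. f (\<beta> a b)) t"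
  by (simp add: tlift_def klinear_sum klinear_iff)

lemma tlift_add: "tlift \<beta> (s + t) = tlift \<beta> s + tlift \<beta> t"
  using klinear_tlift[OF klinear_ident, of \<beta>] by (simp add: klinear_iff)

lemma tlift_scal: "tlift \<beta> (scal c t) = scal c (tlift \<beta> t)"
  using klinear_tlift[OF klinear_ident, of \<beta>] by (simp add: klinear_iff)

lemma klinear_eq_on_tensors:
  assumes "klinear f" "klinear f'" "\<And>v w. f (v \<otimes>\<^sub>K w) = f' (v \<otimes>\<^sub>K w)"
  shows "f t = f' t"
  by (rule klinear_eq_on_unit_vecs[OF assms(1,2)])
     (metis assms(3) surj_pair unit_vec_tensor)

lemma tlift_tlift_tensor:
  assumes "\<And>w. klinear (\<lambda>v. \<beta> v w)" "\<And>v. klinear (\<beta> v)"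
  shows "tlift \<beta> (tlift (\<lambda>a b. f a b \<otimes>\<^sub>K f' a b) t) = tlift (\<lambda>a b. \<beta> (f a b) (f' a b)) t"
  by (simp add: klinear_of_tlift[OF klinear_tlift[OF klinear_ident]] tlift_tensor[of \<beta>, OF assms])

lemmas klinear_intros = klinear_ident klinear_plus klinear_scal klinear_tensor_left
  klinear_tensor_right klinear_tlift klinear_tlift_integrand

text \<open>
  The ground field is identified with the one-dimensional space on the index type \<^typ>\<open>unit\<close>, which
  transfers statements about linear maps to linear forms.
\<close>

lemma tlift_form_eq:
  "tlift_form \<beta> t = Poly_Mapping.lookup (tlift (\<lambda>v w. scal (\<beta> v w) (unit_vec ())) t) ()"
  by (simp add: tlift_form_def tlift_def Poly_Mapping.lookup_sum lookup_unit_vec)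

lemma tlift_form_tensor:
  assumes "\<And>w. klinear_form (\<lambda>v. \<beta> v w)" "\<And>v. klinear_form (\<beta> v)"
  shows "tlift_form \<beta> (v \<otimes>\<^sub>K w) = \<beta> v w"
proof -
  have "tlift (\<lambda>v w. scal (\<beta> v w) (unit_vec ())) (v \<otimes>\<^sub>K w) = scal (\<beta> v w) (unit_vec ())"
    by (rule tlift_tensor) (use assms in \<open>auto intro: klinear_scal_form[OF _ klinear_ident]\<close>)
  then show ?thesis
    by (simp add: tlift_form_eq lookup_unit_vec)
qed

lemma klinear_form_tlift_form: "klinear_form (tlift_form \<beta>)"
  by (simp add: klinear_form_iff tlift_form_eq tlift_add tlift_scal Poly_Mapping.lookup_add)

lemma subspace_equalizer:
  assumes "klinear f" "klinear f'"
  shows "kvec.subspace {v. f v = f' v}"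
  using assms by (simp add: kvec.subspace_def klinear_iff klinear_zero[OF assms(1)] klinear_zero[OF assms(2)])

lemma klinear_eq_on_span:
  assumes "klinear f" "klinear f'" "\<And>b. b \<in> B \<Longrightarrow> f b = f' b" "v \<in> kvec.span B"
  shows "f v = f' v"
  using kvec.span_minimal[of B "{v. f v = f' v}"] subspace_equalizer[OF assms(1,2)] assms(3,4)
  by auto

lemma klinear_maps_span:
  assumes "klinear f" "\<And>b. b \<in> B \<Longrightarrow> f b \<in> kvec.span D" "v \<in> kvec.span B"
  shows "f v \<in> kvec.span D"
proof -
  have "kvec.subspace {v. f v \<in> kvec.span D}"
    using assms(1) by (auto simp: kvec.subspace_def klinear_iff klinear_zero[OF assms(1)]
        kvec.span_zero kvec.span_add kvec.span_scale)
  then show ?thesis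
    using kvec.span_minimal[of B "{v. f v \<in> kvec.span D}"] assms(2,3) by auto
qed

section \<open>Modules over an algebra given by generators and relations\<close>

text \<open>
  The action of an element of the free algebra on a vector space on which each generator \<open>s\<close> acts by
  \<open>\<rho> s\<close>. Evaluation in an algebra is the case of left multiplications, applied to the unit.
\<close>

definition word_action :: "('s \<Rightarrow> ('v \<Rightarrow>\<^sub>0 'k::field) \<Rightarrow> ('v \<Rightarrow>\<^sub>0 'k)) \<Rightarrow> ('s list \<Rightarrow>\<^sub>0 'k) \<Rightarrow>
    ('v \<Rightarrow>\<^sub>0 'k) \<Rightarrow> ('v \<Rightarrow>\<^sub>0 'k)"
  where "word_action \<rho> p v = linear_extension (\<lambda>w. foldr \<rho> w v) p"

lemma word_action_unit_vec [simp]: "word_action \<rho> (unit_vec w) v = foldr \<rho> w v"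
  by (simp add: word_action_def)

lemma word_action_linear:
  shows word_action_add: "word_action \<rho> (p + p') v = word_action \<rho> p v + word_action \<rho> p' v"
    and word_action_diff: "word_action \<rho> (p - p') v = word_action \<rho> p v - word_action \<rho> p' v"
    and word_action_scal: "word_action \<rho> (scal c p) v = scal c (word_action \<rho> p v)"
    and klinear_word_action: "klinear (\<lambda>p. word_action \<rho> p v)"
  using klinear_linear_extension[of "\<lambda>w. foldr \<rho> w v"] klinear_diff[OF klinear_linear_extension]
  by (auto simp: klinear_iff word_action_def)

lemma klinear_foldr: "(\<And>s. klinear (\<rho> s)) \<Longrightarrow> klinear (foldr \<rho> w)"
  by (induction w) (auto simp: id_def klinear_ident o_def intro: klinear_comp)

lemma word_mult_action:
  assumes "\<And>s. klinear (\<rho> s)"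
  shows "word_action \<rho> (word_mult a p b) v = foldr \<rho> a (word_action \<rho> p (foldr \<rho> b v))"
  by (simp add: word_mult_def klinear_sum[OF klinear_word_action] word_action_scal)
     (simp add: word_action_def linear_extension_def klinear_sum[OF klinear_foldr[OF assms]]
        klinear_foldr[OF assms, unfolded klinear_iff])

lemma free_eval_eq_word_action:
  "free_eval A \<gamma> p = word_action (\<lambda>s. hmul A (\<gamma> s)) p (hone A)"
  by (simp add: free_eval_def word_action_def linear_extension_def)

lemma presented_by_relation:
  assumes "presented_by A \<gamma> R" "r \<in> R"
  shows "free_eval A \<gamma> r = 0"
proof -
  have "r = word_mult [] r []"
    by (simp add: word_mult_def unit_vec_expansion[symmetric])
  then have "r \<in> free_ideal R"
    using assms(2) unfolding free_ideal_def by (intro kvec.span_base) blast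
  then show ?thesis
    using assms(1) by (auto simp: presented_by_def)
qed

lemma klinear_hmul_right: "klinear (hmult A) \<Longrightarrow> klinear f \<Longrightarrow> klinear (\<lambda>v. hmul A a (f v))"
  by (erule klinear_comp) (rule klinear_tensor_right)

lemma klinear_hmul_left: "klinear (hmult A) \<Longrightarrow> klinear f \<Longrightarrow> klinear (\<lambda>v. hmul A (f v) a)"
  by (erule klinear_comp) (rule klinear_tensor_left)

text \<open>
  Every element is a linear combination of words in the generators, and a word is built from the unit
  by left multiplications.
\<close>

lemma presented_by_induct:
  assumes "presented_by A \<gamma> R" "kvec.subspace S" "hone A \<in> S"
    and "\<And>s z. z \<in> S \<Longrightarrow> hmul A (\<gamma> s) z \<in> S"
  shows "z \<in> S"
proof -
  have "foldr (\<lambda>s a. hmul A (\<gamma> s) a) w (hone A) \<in> S" for w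
    by (induction w) (use assms in auto)
  then have "free_eval A \<gamma> p \<in> S" for p
    unfolding free_eval_def by (intro kvec.subspace_sum kvec.subspace_scale assms(2))
  moreover obtain p where "free_eval A \<gamma> p = z"
    using assms(1) unfolding presented_by_def by (metis surjD)
  ultimately show ?thesis by blast
qed

text \<open>
  A vector space on which the generators act so that the relations act by zero is a module over the
  presented algebra, and acting on a vector \<open>v0\<close> is a module map out of the algebra. Concretely, the
  map sends the value of a free polynomial \<open>p\<close> to \<open>p\<close> acting on \<open>v0\<close>; this does not depend on the choice
  of \<open>p\<close> because the ideal of relations acts by zero.
\<close>

lemma presented_by_universal:
  fixes \<rho> :: "'s \<Rightarrow> ('v \<Rightarrow>\<^sub>0 'k::field) \<Rightarrow> ('v \<Rightarrow>\<^sub>0 'k)"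
  assumes pres: "presented_by A \<gamma> R" and lin: "\<And>s. klinear (\<rho> s)"
    and rel: "\<And>r v. r \<in> R \<Longrightarrow> word_action \<rho> r v = 0"
  shows "\<exists>F. klinear F \<and> F (hone A) = v0 \<and> (\<forall>s z. F (hmul A (\<gamma> s) z) = \<rho> s (F z))"
proof -
  let ?ev = "free_eval A \<gamma>" and ?act = "\<lambda>p. word_action \<rho> p v0"
  have Alin: "\<And>s. klinear (\<lambda>z. hmul A (\<gamma> s) z)"
    using pres by (intro klinear_hmul_right klinear_ident) (simp add: presented_by_def unital_algebra_def)
  have ideal: "?act p = 0" if "p \<in> free_ideal R" for p
  proof -
    have "?act p = 0" if "p \<in> kvec.span {word_mult a r b | a r b. r \<in> R}"
      by (rule klinear_eq_on_span[OF klinear_word_action klinear_const_zero _ that])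
         (auto simp: word_mult_action[OF lin] rel klinear_zero[OF klinear_foldr[OF lin]])
    then show ?thesis using that by (simp add: free_ideal_def)
  qed
  have welldef: "?act p = ?act p'" if "?ev p = ?ev p'" for p p'
  proof -
    have "?ev (p - p') = 0"
      using that by (simp add: free_eval_eq_word_action word_action_diff)
    then have "p - p' \<in> free_ideal R"
      using pres by (auto simp: presented_by_def)
    from ideal[OF this] show ?thesis
      by (simp add: word_action_diff)
  qed
  define F where "F z = ?act (SOME p. ?ev p = z)" for z
  have F: "F (?ev p) = ?act p" for p
    unfolding F_def by (rule welldef) (rule someI[of "\<lambda>p'. ?ev p' = ?ev p"], rule refl)
  have ex: "\<exists>p. z = ?ev p" for z
    using pres unfolding presented_by_def by (metis surjD)
  have "klinear F"
    unfolding klinear_iff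
  proof safe
    fix y z
    obtain p p' where "y = ?ev p" "z = ?ev p'" using ex by metis
    moreover from this have "y + z = ?ev (p + p')"
      by (simp add: free_eval_eq_word_action word_action_add)
    ultimately show "F (y + z) = F y + F z"
      by (simp only: F word_action_add)
  next
    fix c z
    obtain p where "z = ?ev p" using ex by metis
    moreover from this have "scal c z = ?ev (scal c p)"
      by (simp add: free_eval_eq_word_action word_action_scal)
    ultimately show "F (scal c z) = scal c (F z)"
      by (simp only: F word_action_scal)
  qed
  moreover have "F (hone A) = v0"
    using F[of "unit_vec []"] by (simp add: free_eval_eq_word_action)
  moreover have "F (hmul A (\<gamma> s) z) = \<rho> s (F z)" for s z
  proof -
    obtain p where p: "z = ?ev p" using ex by metis
    then have "hmul A (\<gamma> s) z = ?ev (word_mult [s] p [])"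
      by (simp add: free_eval_eq_word_action word_mult_action[OF Alin])
    then show ?thesis
      by (simp only: p F) (simp add: word_mult_action[OF lin])
  qed
  ultimately show ?thesis by blast
qed

section \<open>Algebras and bialgebras\<close>

lemma unital_algebraD:
  assumes "unital_algebra A"
  shows hmult_linear: "klinear (hmult A)"
    and hmul_assoc: "hmul A (hmul A a b) c = hmul A a (hmul A b c)"
    and hmul_one_left: "hmul A (hone A) a = a"
    and hmul_one_right: "hmul A a (hone A) = a"
  using assms by (auto simp: unital_algebra_def)

lemma hmul_bilinear:
  assumes "unital_algebra A"
  shows hmul_add_left: "hmul A (a + a') b = hmul A a b + hmul A a' b"
    and hmul_add_right: "hmul A b (a + a') = hmul A b a + hmul A b a'"
    and hmul_scal_left: "hmul A (scal r a) b = scal r (hmul A a b)"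
    and hmul_scal_right: "hmul A b (scal r a) = scal r (hmul A b a)"
    and hmul_zero_left: "hmul A 0 b = 0"
    and hmul_zero_right: "hmul A b 0 = 0"
  using hmult_linear[OF assms]
  by (auto simp: klinear_iff tensor_add_left tensor_add_right tensor_scal_left tensor_scal_right
      klinear_zero)

lemma hpow_add:
  "unital_algebra A \<Longrightarrow> hpow A a (i + j) = hmul A (hpow A a i) (hpow A a j)"
  by (induction i) (simp_all add: hmul_one_left hmul_assoc)

lemma hpow_one_base: "unital_algebra A \<Longrightarrow> hpow A (hone A) i = hone A"
  by (induction i) (simp_all add: hmul_one_left)

lemma hpow_mult: "unital_algebra A \<Longrightarrow> hpow A a (i * j) = hpow A (hpow A a i) j"
  by (induction j) (simp_all add: hpow_add)

lemma hopf_algebraD: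
  assumes "hopf_algebra A"
  shows hopf_unital: "unital_algebra A"
    and comult_linear: "klinear (comult A)"
    and counit_linear: "klinear_form (counit A)"
    and counit_left: "tlift (\<lambda>c1 c2. scal (counit A c1) c2) (comult A a) = a"
    and counit_right: "tlift (\<lambda>c1 c2. scal (counit A c2) c1) (comult A a) = a"
    and comult_hmul: "comult A (hmul A a b) =
       tlift (\<lambda>a1 a2. tlift (\<lambda>b1 b2. hmul A a1 b1 \<otimes>\<^sub>K hmul A a2 b2) (comult A b)) (comult A a)"
    and comult_hone: "comult A (hone A) = hone A \<otimes>\<^sub>K hone A"
    and counit_hmul: "counit A (hmul A a b) = counit A a * counit A b"
    and counit_hone: "counit A (hone A) = 1"
  using assms by (auto simp: hopf_algebra_def bialgebra_def coalgebra_def)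

lemma comult_hmul_tensor:
  assumes A: "hopf_algebra A" and "comult A a = v \<otimes>\<^sub>K w"
  shows "comult A (hmul A a b) = tlift (\<lambda>b1 b2. hmul A v b1 \<otimes>\<^sub>K hmul A w b2) (comult A b)"
proof -
  note lin = hmult_linear[OF hopf_unital[OF A]]
  show ?thesis
    unfolding comult_hmul[OF A] assms(2)
    by (rule tlift_tensor) (intro klinear_intros klinear_hmul_left[OF lin])+
qed

lemma comult_hmul_tensor_sum:
  assumes A: "hopf_algebra A" and "comult A a = v \<otimes>\<^sub>K w + v' \<otimes>\<^sub>K w'"
  shows "comult A (hmul A a b) = tlift (\<lambda>b1 b2. hmul A v b1 \<otimes>\<^sub>K hmul A w b2) (comult A b)
    + tlift (\<lambda>b1 b2. hmul A v' b1 \<otimes>\<^sub>K hmul A w' b2) (comult A b)"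
proof -
  note lin = hmult_linear[OF hopf_unital[OF A]]
  show ?thesis
    unfolding comult_hmul[OF A] assms(2) tlift_add
    by (intro arg_cong2[where f = "(+)"] tlift_tensor) (intro klinear_intros klinear_hmul_left[OF lin])+
qed

lemma hpow_grouplike:
  assumes A: "hopf_algebra A" and a: "comult A a = a \<otimes>\<^sub>K a"
  shows "comult A (hpow A a i) = hpow A a i \<otimes>\<^sub>K hpow A a i"
proof (induction i)
  case 0
  show ?case by (simp add: comult_hone[OF A])
next
  case (Suc i)
  note lin = hmult_linear[OF hopf_unital[OF A]]
  show ?case
    unfolding hpow.simps comult_hmul_tensor[OF A a] Suc
    by (rule tlift_tensor) (intro klinear_intros klinear_hmul_right[OF lin])+
qed

lemma klinear_comult: "hopf_algebra A \<Longrightarrow> klinear f \<Longrightarrow> klinear (\<lambda>v. comult A (f v))"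
  by (rule klinear_comp) (rule comult_linear)

definition bialgebra_endo ::
  "('i, 'k::field, 'z) hopf_scheme \<Rightarrow> (('i \<Rightarrow>\<^sub>0 'k) \<Rightarrow> ('i \<Rightarrow>\<^sub>0 'k)) \<Rightarrow> bool"
  where "bialgebra_endo A \<phi> \<longleftrightarrow> klinear \<phi> \<and> \<phi> (hone A) = hone A \<and>
    (\<forall>y z. \<phi> (hmul A y z) = hmul A (\<phi> y) (\<phi> z)) \<and>
    (\<forall>z. comult A (\<phi> z) = tlift (\<lambda>z1 z2. \<phi> z1 \<otimes>\<^sub>K \<phi> z2) (comult A z)) \<and>
    (\<forall>z. counit A (\<phi> z) = counit A z)"

section \<open>The monomial basis of a Taft algebra\<close>

text \<open>
  The operators by which left multiplication with \<open>h\<close> and \<open>x\<close> should act on the basis vectors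
  \<open>e(i, j)\<close> standing for \<open>h\<^sup>i x\<^sup>j\<close>. The index type also contains pairs outside the range \<open>i, j < m\<close>;
  for \<open>i \<ge> m\<close> the first operator is the identity and the second is zero, so that the Taft relations hold
  on the whole space.
\<close>

definition model_h :: "nat \<Rightarrow> (nat \<times> nat \<Rightarrow>\<^sub>0 'k::field) \<Rightarrow> (nat \<times> nat \<Rightarrow>\<^sub>0 'k)"
  where "model_h m = linear_extension (\<lambda>(i, j). unit_vec (if i < m then (Suc i mod m, j) else (i, j)))"

definition model_x :: "nat \<Rightarrow> 'k \<Rightarrow> (nat \<times> nat \<Rightarrow>\<^sub>0 'k::field) \<Rightarrow> (nat \<times> nat \<Rightarrow>\<^sub>0 'k)"
  where "model_x m q = linear_extension
    (\<lambda>(i, j). if i < m \<and> Suc j < m then scal (q ^ i) (unit_vec (i, Suc j)) else 0)"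

lemma klinear_model: "klinear (model_h m)" "klinear (model_x m q)"
  unfolding model_h_def model_x_def by (rule klinear_linear_extension)+

lemma model_h_unit_vec [simp]:
    "model_h m (unit_vec (i, j)) = unit_vec (if i < m then (Suc i mod m, j) else (i, j))"
  and model_x_unit_vec [simp]: "model_x m q (unit_vec (i, j)) =
    (if i < m \<and> Suc j < m then scal (q ^ i) (unit_vec (i, Suc j)) else 0)"
  by (simp_all add: model_h_def model_x_def)

lemma model_scal [simp]: "model_h m (scal r v) = scal r (model_h m v)"
    "model_x m q (scal r v) = scal r (model_x m q v)"
  and model_zero [simp]: "model_h m 0 = 0" "model_x m q 0 = 0"
  using klinear_model[unfolded klinear_iff] klinear_zero[OF klinear_model(1)]
    klinear_zero[OF klinear_model(2)] by blast+

lemma model_h_power: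
  "(model_h m ^^ l) (unit_vec (i, j)) = unit_vec (if i < m then ((i + l) mod m, j) else (i, j))"
  by (induction l) (auto simp: mod_Suc_eq)

lemma model_x_power:
  assumes "m > 0"
  shows "(model_x m q ^^ l) (unit_vec (i, j)) =
    (if l = 0 then unit_vec (i, j)
     else if i < m \<and> j + l < m then scal (q ^ (i * l)) (unit_vec (i, j + l)) else 0)"
  by (induction l) (auto simp: power_add mult.commute)

locale taft =
  fixes m :: nat and q :: "'k::field"
    and T :: "('t, 'k) hopf" and h x :: "'t \<Rightarrow>\<^sub>0 'k"
  assumes m_ge_2: "m \<ge> 2"
    and primitive: "primitive_root_of_unity m q"
    and taft: "taft_algebra m q T h x"
begin

abbreviation mul (infixl "\<cdot>" 80) where "a \<cdot> b \<equiv> hmul T a b"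

abbreviation one ("\<one>\<^sub>T") where "\<one>\<^sub>T \<equiv> hone T"

definition monomial :: "nat \<Rightarrow> nat \<Rightarrow> 't \<Rightarrow>\<^sub>0 'k"
  where "monomial i j = hpow T h i \<cdot> hpow T x j"

lemma q_power_m: "q ^ m = 1"
proof -
  have "q powi 1 \<in> {q powi i | i :: int. True}" by blast
  then show ?thesis
    using primitive by (simp add: primitive_root_of_unity_def roots_of_unity_def) blast
qed

lemma q_nonzero: "q \<noteq> 0"
  using q_power_m m_ge_2 by (auto simp: power_0_left)

lemma q_power_mod: "q ^ (i mod m) = q ^ i"
proof -
  have "q ^ i = q ^ (i mod m + m * (i div m))" by simp
  then show ?thesis by (simp only: power_add power_mult q_power_m) simp
qed

lemma q_power_inj: "inj_on (\<lambda>i. q ^ i) {..<m}"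
proof (rule eq_card_imp_inj_on)
  have "q powi i \<in> (\<lambda>i. q ^ i) ` {..<m}" for i :: int
  proof -
    have "q powi i = q powi (int m * (i div int m) + i mod int m)" by simp
    also have "\<dots> = (q powi int m) powi (i div int m) * q powi (i mod int m)"
      by (simp only: power_int_add[OF disjI1[OF q_nonzero]] power_int_mult)
    also have "\<dots> = q powi (int (nat (i mod int m)))"
      using m_ge_2 by (simp add: q_power_m)
    finally have "q powi i = q ^ nat (i mod int m)" by (simp only: power_int_of_nat)
    moreover have "nat (i mod int m) < m" using m_ge_2 by (simp add: nat_less_iff)
    ultimately show ?thesis by blast
  qed
  moreover have "q ^ i \<in> {q powi i | i :: int. True}" for i :: nat
    by (metis (mono_tags, lifting) mem_Collect_eq power_int_of_nat)
  ultimately have "(\<lambda>i. q ^ i) ` {..<m} = {q powi i | i :: int. True}" by blast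
  then show "card ((\<lambda>i. q ^ i) ` {..<m}) = card {..<m}"
    using primitive unfolding primitive_root_of_unity_def by (metis card_lessThan)
qed simp

lemma q_power_eq_q: "q ^ i = q \<longleftrightarrow> i mod m = 1"
proof -
  have "q ^ i = q \<longleftrightarrow> q ^ (i mod m) = q ^ 1" by (simp add: q_power_mod)
  also have "\<dots> \<longleftrightarrow> i mod m = 1"
    by (rule inj_on_eq_iff[OF q_power_inj]) (use m_ge_2 in auto)
  finally show ?thesis .
qed

lemma hopf: "hopf_algebra T"
  and presented: "presented_by T (case_taft_symbol h x) (taft_relations m q)"
  and comult_h: "comult T h = h \<otimes>\<^sub>K h"
  and comult_x: "comult T x = x \<otimes>\<^sub>K h + \<one>\<^sub>T \<otimes>\<^sub>K x"
  and counit_h: "counit T h = 1" and counit_x: "counit T x = 0"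
  using taft by (auto simp: taft_algebra_def)

lemmas unital = hopf_unital[OF hopf]
lemmas mult_linear = hmult_linear[OF unital]
lemmas mul_assoc = hmul_assoc[OF unital]
lemmas one_mul [simp] = hmul_one_left[OF unital]
lemmas mul_one [simp] = hmul_one_right[OF unital]
lemmas mul_simps [simp] = hmul_bilinear[OF unital] klinear_zero[OF mult_linear]
lemmas pow_add = hpow_add[OF unital]
lemmas mul_klinear_intros =
  klinear_intros klinear_hmul_left[OF mult_linear] klinear_hmul_right[OF mult_linear]

lemma taft_induct:
  assumes "kvec.subspace S" "\<one>\<^sub>T \<in> S" "\<And>z. z \<in> S \<Longrightarrow> h \<cdot> z \<in> S" "\<And>z. z \<in> S \<Longrightarrow> x \<cdot> z \<in> S"
  shows "z \<in> S"
  by (rule presented_by_induct[OF presented assms(1,2)])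
     (use assms(3,4) in \<open>simp split: taft_symbol.split\<close>)

lemma klinear_eq_taft:
  assumes "klinear f" "klinear f'" "f \<one>\<^sub>T = f' \<one>\<^sub>T"
    and "\<And>z. f z = f' z \<Longrightarrow> f (h \<cdot> z) = f' (h \<cdot> z)" "\<And>z. f z = f' z \<Longrightarrow> f (x \<cdot> z) = f' (x \<cdot> z)"
  shows "f z = f' z"
  using taft_induct[OF subspace_equalizer[OF assms(1,2)]] assms(3-5) by simp

text \<open>
  The universal property of the presentation for the three Taft relations. It provides all linear maps
  out of \<open>T\<close> that are needed: the coordinates with respect to the monomials, and the rescalings of \<open>x\<close>.
\<close>

lemma taft_universal:
  fixes H X :: "('v \<Rightarrow>\<^sub>0 'k) \<Rightarrow> ('v \<Rightarrow>\<^sub>0 'k)"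
  assumes "klinear H" "klinear X" "\<And>v. (H ^^ m) v = v" "\<And>v. (X ^^ m) v = 0"
    "\<And>v. X (H v) = scal q (H (X v))"
  shows "\<exists>F. klinear F \<and> F \<one>\<^sub>T = v0 \<and> (\<forall>z. F (h \<cdot> z) = H (F z)) \<and> (\<forall>z. F (x \<cdot> z) = X (F z))"
proof -
  let ?\<rho> = "case_taft_symbol H X"
  have pow: "foldr ?\<rho> (replicate l s) v = (?\<rho> s ^^ l) v" for l s v
    by (induction l) auto
  have "\<exists>F. klinear F \<and> F \<one>\<^sub>T = v0 \<and> (\<forall>s z. F (case_taft_symbol h x s \<cdot> z) = ?\<rho> s (F z))"
  proof (rule presented_by_universal[OF presented])
    show "klinear (?\<rho> s)" for s using assms(1,2) by (simp split: taft_symbol.split)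
    show "word_action ?\<rho> r v = 0" if "r \<in> taft_relations m q" for r v
      using that by (auto simp: taft_relations_def word_action_diff word_action_scal pow assms(3-5))
  qed
  then show ?thesis by (metis taft_symbol.case)
qed

lemma funpow_mul: "((\<lambda>b. a \<cdot> b) ^^ i) b = hpow T a i \<cdot> b"
  by (induction i) (simp_all add: mul_assoc)

lemma h_power_m: "hpow T h m = \<one>\<^sub>T"
  and x_power_m: "hpow T x m = 0"
  and x_mul_h: "x \<cdot> h = scal q (h \<cdot> x)"
proof -
  have rel: "free_eval T (case_taft_symbol h x) r = 0" if "r \<in> taft_relations m q" for r
    by (rule presented_by_relation[OF presented that])
  show "hpow T h m = \<one>\<^sub>T" "hpow T x m = 0" "x \<cdot> h = scal q (h \<cdot> x)"
    using rel[of "unit_vec (replicate m Sym_h) - unit_vec []"] rel[of "unit_vec (replicate m Sym_x)"]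
      rel[of "unit_vec [Sym_x, Sym_h] - scal q (unit_vec [Sym_h, Sym_x])"]
    by (simp_all add: taft_relations_def free_eval_eq_word_action word_action_diff
        word_action_scal funpow_mul)
qed

lemma h_power_mod: "hpow T h (i mod m) = hpow T h i"
proof -
  have "hpow T h i = hpow T h (i mod m + m * (i div m))" by simp
  also have "\<dots> = hpow T h (i mod m)"
    by (simp only: pow_add hpow_mult[OF unital] h_power_m hpow_one_base[OF unital] mul_one)
  finally show ?thesis ..
qed

lemma x_power_ge: "j \<ge> m \<Longrightarrow> hpow T x j = 0"
  using pow_add[of x m "j - m"] by (simp add: x_power_m)

lemma x_mul_h_power: "x \<cdot> hpow T h i = scal (q ^ i) (hpow T h i \<cdot> x)"
proof (induction i)
  case 0
  show ?case by simp
next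
  case (Suc i)
  have "x \<cdot> hpow T h (Suc i) = scal q (h \<cdot> (x \<cdot> hpow T h i))"
    by (simp add: mul_assoc[symmetric] x_mul_h)
  then show ?case by (simp add: Suc mul_assoc)
qed

lemma x_power_mul_h_power:
  "hpow T x j \<cdot> hpow T h i = scal (q ^ (i * j)) (hpow T h i \<cdot> hpow T x j)"
proof (induction j)
  case 0
  show ?case by simp
next
  case (Suc j)
  have "hpow T x (Suc j) \<cdot> hpow T h i = scal (q ^ (i * j)) ((x \<cdot> hpow T h i) \<cdot> hpow T x j)"
    by (simp add: mul_assoc Suc)
  then show ?case by (simp add: x_mul_h_power mul_assoc power_add mult.commute)
qed

lemma h_mul_monomial: "h \<cdot> monomial i j = monomial (Suc i) j"
  by (simp add: monomial_def mul_assoc)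

lemma x_mul_monomial: "x \<cdot> monomial i j = scal (q ^ i) (monomial i (Suc j))"
  by (simp add: monomial_def mul_assoc[symmetric] x_mul_h_power)

lemma monomial_mul_monomial:
  "monomial i j \<cdot> monomial k l = scal (q ^ (k * j)) (monomial (i + k) (j + l))"
proof -
  have "monomial i j \<cdot> monomial k l = hpow T h i \<cdot> ((hpow T x j \<cdot> hpow T h k) \<cdot> hpow T x l)"
    by (simp add: monomial_def mul_assoc)
  then show ?thesis by (simp add: x_power_mul_h_power monomial_def mul_assoc pow_add)
qed

lemma monomial_0_0: "monomial 0 0 = \<one>\<^sub>T" and monomial_h_power: "monomial i 0 = hpow T h i"
  and monomial_x_power: "monomial 0 j = hpow T x j"
  by (simp_all add: monomial_def)

lemma monomial_1_0: "monomial 1 0 = h" and monomial_0_1: "monomial 0 1 = x"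
  by (simp_all add: monomial_def)

lemma monomial_mod: "monomial (i mod m) j = monomial i j"
  by (simp add: monomial_def h_power_mod)

lemma monomial_ge: "j \<ge> m \<Longrightarrow> monomial i j = 0"
  by (simp add: monomial_def x_power_ge)

lemma monomials_span: "z \<in> kvec.span {monomial i j | i j. i < m \<and> j < m}" (is "z \<in> kvec.span ?B")
proof (rule taft_induct)
  have mono: "monomial i j \<in> kvec.span ?B" for i j
  proof (cases "j < m")
    case True
    then have "monomial (i mod m) j \<in> ?B"
      using m_ge_2 by (intro CollectI exI[of _ "i mod m"] exI[of _ j]) auto
    then show ?thesis by (simp add: monomial_mod kvec.span_base)
  next
    case False
    then show ?thesis by (simp add: monomial_ge kvec.span_zero)
  qed
  show "kvec.subspace (kvec.span ?B)" by (rule kvec.subspace_span)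
  show "\<one>\<^sub>T \<in> kvec.span ?B" using mono[of 0 0] by (simp add: monomial_0_0)
  show "h \<cdot> z \<in> kvec.span ?B" if "z \<in> kvec.span ?B" for z
    by (rule klinear_maps_span[OF _ _ that])
       (auto intro: mul_klinear_intros simp: h_mul_monomial mono)
  show "x \<cdot> z \<in> kvec.span ?B" if "z \<in> kvec.span ?B" for z
    by (rule klinear_maps_span[OF _ _ that])
       (auto intro: mul_klinear_intros simp: x_mul_monomial mono kvec.span_scale)
qed

lemma klinear_eq_on_monomials:
  assumes "klinear f" "klinear f'" "\<And>i j. i < m \<Longrightarrow> j < m \<Longrightarrow> f (monomial i j) = f' (monomial i j)"
  shows "f z = f' z"
  by (rule klinear_eq_on_span[OF assms(1,2) _ monomials_span]) (use assms(3) in auto)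

text \<open>
  Applied to the model operators and the vector \<open>e(0, 0)\<close>, the universal property gives a linear map that
  separates the monomials. This is the linear independence of the monomial basis.
\<close>

lemma ex_coordinates:
  "\<exists>F :: ('t \<Rightarrow>\<^sub>0 'k) \<Rightarrow> (nat \<times> nat \<Rightarrow>\<^sub>0 'k). klinear F \<and>
     (\<forall>i j. F (monomial i j) = (if j < m then unit_vec (i mod m, j) else 0))"
proof -
  let ?H = "model_h m :: _ \<Rightarrow> (nat \<times> nat \<Rightarrow>\<^sub>0 'k)" and ?X = "model_x m q"
  have m0: "m > 0" using m_ge_2 by simp
  have lin: "klinear (?H ^^ l)" "klinear (?X ^^ l)" for l
    by (induction l) (auto simp: id_def klinear_ident o_def klinear_model intro: klinear_comp)
  have "\<exists>F. klinear F \<and> F \<one>\<^sub>T = unit_vec (0, 0) \<and> (\<forall>z. F (h \<cdot> z) = ?H (F z)) \<and>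
      (\<forall>z. F (x \<cdot> z) = ?X (F z))"
  proof (rule taft_universal)
    show "klinear ?H" "klinear ?X" by (rule klinear_model)+
    show "(?H ^^ m) v = v" for v
      by (rule klinear_eq_on_unit_vecs[OF lin(1) klinear_ident]) (auto simp: model_h_power)
    show "(?X ^^ m) v = 0" for v
      by (rule klinear_eq_on_unit_vecs[OF lin(2) klinear_const_zero])
         (use m0 in \<open>auto simp: model_x_power\<close>)
    have "klinear (\<lambda>v. ?X (?H v))" "klinear (\<lambda>v. scal q (?H (?X v)))"
      by (intro klinear_scal klinear_comp[OF klinear_model(1)] klinear_comp[OF klinear_model(2)]
          klinear_model)+
    then show "?X (?H v) = scal q (?H (?X v))" for v
      by (rule klinear_eq_on_unit_vecs) (use m0 in \<open>auto simp: q_power_mod\<close>)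
  qed
  then obtain F where F: "klinear F" "F \<one>\<^sub>T = unit_vec (0, 0)"
    and Fh: "\<And>z. F (h \<cdot> z) = ?H (F z)" and Fx: "\<And>z. F (x \<cdot> z) = ?X (F z)" by blast
  have "F (monomial 0 j) = (?X ^^ j) (unit_vec (0, 0))" for j
    by (induction j) (simp_all add: monomial_0_0 F Fx monomial_x_power)
  then have *: "F (monomial 0 j) = (if j < m then unit_vec (0, j) else 0)" for j
    using m0 by (simp add: model_x_power)
  have "F (monomial i j) = (?H ^^ i) (F (monomial 0 j))" for i j
    by (induction i) (simp_all add: Fh h_mul_monomial[symmetric])
  then have "F (monomial i j) = (if j < m then unit_vec (i mod m, j) else 0)" for i j
    using m0 by (simp add: * model_h_power klinear_zero[OF lin(1)])
  with F(1) show ?thesis by blast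
qed

definition coord :: "('t \<Rightarrow>\<^sub>0 'k) \<Rightarrow> (nat \<times> nat \<Rightarrow>\<^sub>0 'k)"
  where "coord = (SOME F. klinear F \<and>
     (\<forall>i j. F (monomial i j) = (if j < m then unit_vec (i mod m, j) else 0)))"

lemma klinear_coord: "klinear coord"
  and coord_monomial: "coord (monomial i j) = (if j < m then unit_vec (i mod m, j) else 0)"
  using someI_ex[OF ex_coordinates] unfolding coord_def by blast+

abbreviation cf :: "nat \<Rightarrow> nat \<Rightarrow> ('t \<Rightarrow>\<^sub>0 'k) \<Rightarrow> 'k"
  where "cf i j z \<equiv> Poly_Mapping.lookup (coord z) (i, j)"

lemma cf_monomial: "cf a b (monomial i j) = (if j < m \<and> i mod m = a \<and> j = b then 1 else 0)"
  by (simp add: coord_monomial lookup_unit_vec)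

lemma cf_linear:
  "cf a b (y + z) = cf a b y + cf a b z" "cf a b (y - z) = cf a b y - cf a b z"
  "cf a b (scal r z) = r * cf a b z" "cf a b 0 = 0"
  using klinear_coord klinear_diff[OF klinear_coord]
  by (auto simp: klinear_iff Poly_Mapping.lookup_add Poly_Mapping.lookup_minus
      klinear_zero[OF klinear_coord])

lemma monomial_expansion: "z = (\<Sum>i<m. \<Sum>j<m. scal (cf i j z) (monomial i j))"
proof (rule klinear_eq_on_monomials[of "\<lambda>z. z" "\<lambda>z. \<Sum>i<m. \<Sum>j<m. scal (cf i j z) (monomial i j)" z])
  show "klinear (\<lambda>z. z)" by (rule klinear_ident)
  show "klinear (\<lambda>z. \<Sum>i<m. \<Sum>j<m. scal (cf i j z) (monomial i j))"
    by (intro klinear_sum_fun klinear_lookup klinear_coord)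
  fix a b assume ab: "a < m" "b < m"
  have "(\<Sum>i<m. \<Sum>j<m. scal (cf i j (monomial a b)) (monomial i j)) =
      (\<Sum>i<m. \<Sum>j<m. if j = b then if i = a then monomial i j else 0 else 0)"
    using ab by (intro sum.cong) (auto simp: cf_monomial)
  also have "\<dots> = monomial a b"
    using ab by simp
  finally show "monomial a b = (\<Sum>i<m. \<Sum>j<m. scal (cf i j (monomial a b)) (monomial i j))" ..
qed

lemma cf_eqI: "(\<And>i j. i < m \<Longrightarrow> j < m \<Longrightarrow> cf i j y = cf i j z) \<Longrightarrow> y = z"
  by (subst monomial_expansion[of y], subst monomial_expansion[of z]) simp

lemma x_power_nonzero: "j < m \<Longrightarrow> hpow T x j \<noteq> 0"
  using cf_monomial[of 0 j 0 j] m_ge_2 by (auto simp: monomial_x_power cf_linear)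

lemma x_nonzero: "x \<noteq> 0"
  using x_power_nonzero[of 1] m_ge_2 by simp

section \<open>Group-like elements of a Taft algebra\<close>

lemma comult_h_mul: "comult T (h \<cdot> z) = tlift (\<lambda>b1 b2. h \<cdot> b1 \<otimes>\<^sub>K h \<cdot> b2) (comult T z)"
  by (rule comult_hmul_tensor[OF hopf comult_h])

lemma comult_x_mul: "comult T (x \<cdot> z) =
    tlift (\<lambda>b1 b2. x \<cdot> b1 \<otimes>\<^sub>K h \<cdot> b2) (comult T z) + tlift (\<lambda>b1 b2. b1 \<otimes>\<^sub>K x \<cdot> b2) (comult T z)"
  using comult_hmul_tensor_sum[OF hopf comult_x] by simp

lemma comult_h_power: "comult T (hpow T h i) = hpow T h i \<otimes>\<^sub>K hpow T h i"
  by (rule hpow_grouplike[OF hopf comult_h])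

lemma counit_h_power: "counit T (hpow T h i) = 1"
  by (induction i) (simp_all add: counit_hone[OF hopf] counit_hmul[OF hopf] counit_h)

text \<open>
  The part of \<open>T \<otimes> T\<close> of total degree \<open>d\<close> in \<open>x\<close>.
\<close>

definition bidegree :: "nat \<Rightarrow> ('t \<times> 't \<Rightarrow>\<^sub>0 'k) set"
  where "bidegree d = kvec.span {monomial i j \<otimes>\<^sub>K monomial k l | i j k l. j + l = d}"

lemma bidegree_base: "j + l = d \<Longrightarrow> monomial i j \<otimes>\<^sub>K monomial k l \<in> bidegree d"
  unfolding bidegree_def by (rule kvec.span_base) blast

lemma tlift_bidegree:
  assumes "\<And>w. klinear (\<lambda>v. \<beta> v w)" "\<And>v. klinear (\<beta> v)"
    and "\<And>i j k l. j + l = d \<Longrightarrow> \<beta> (monomial i j) (monomial k l) \<in> bidegree e"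
    and "t \<in> bidegree d"
  shows "tlift \<beta> t \<in> bidegree e"
  using assms(4) unfolding bidegree_def
  by (rule klinear_maps_span[rotated 2])
     (use assms(3) in \<open>auto intro: klinear_intros simp: tlift_tensor[of \<beta>, OF assms(1,2)] bidegree_def\<close>)

text \<open>
  Comultiplication preserves the degree in \<open>x\<close>: multiplying by \<open>\<Delta> h = h \<otimes> h\<close> keeps the total degree, and
  each summand of \<open>\<Delta> x = x \<otimes> h + 1 \<otimes> x\<close> raises it by one.
\<close>

lemma comult_monomial: "comult T (monomial i j) \<in> bidegree j"
proof -
  have lins: "klinear (\<lambda>v. h \<cdot> v \<otimes>\<^sub>K h \<cdot> w)" "klinear (\<lambda>v. h \<cdot> w \<otimes>\<^sub>K h \<cdot> v)"
    "klinear (\<lambda>v. x \<cdot> v \<otimes>\<^sub>K h \<cdot> w)" "klinear (\<lambda>v. x \<cdot> w \<otimes>\<^sub>K h \<cdot> v)"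
    "klinear (\<lambda>v. v \<otimes>\<^sub>K x \<cdot> w)" "klinear (\<lambda>v. w \<otimes>\<^sub>K x \<cdot> v)" for w
    by (intro mul_klinear_intros)+
  have add: "s + t \<in> bidegree d" if "s \<in> bidegree d" "t \<in> bidegree d" for s t d
    using that by (simp add: bidegree_def kvec.span_add)
  have scale: "scal r t \<in> bidegree d" if "t \<in> bidegree d" for r t d
    using that by (simp add: bidegree_def kvec.span_scale)
  have "comult T (monomial 0 j) \<in> bidegree j"
  proof (induction j)
    case 0
    show ?case
      using bidegree_base[of 0 0 0 0 0] by (simp add: monomial_0_0 comult_hone[OF hopf])
  next
    case (Suc j)
    have eq: "monomial 0 (Suc j) = x \<cdot> monomial 0 j"
      by (simp add: monomial_x_power)
    show ?case
      unfolding eq comult_x_mul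
      by (intro add tlift_bidegree[OF _ _ _ Suc] lins)
         (auto intro!: scale bidegree_base
           simp: h_mul_monomial x_mul_monomial tensor_scal_left tensor_scal_right)
  qed
  then show ?thesis
  proof (induction i)
    case (Suc i)
    have "comult T (monomial i j) \<in> bidegree j" using Suc by blast
    then show ?case
      unfolding h_mul_monomial[symmetric] comult_h_mul
      by (rule tlift_bidegree[rotated 3])
         (auto intro: lins bidegree_base simp: h_mul_monomial)
  qed
qed

text \<open>
  The coefficient at a tensor product of two monomials.
\<close>

definition cf2 :: "nat \<times> nat \<Rightarrow> nat \<times> nat \<Rightarrow> ('t \<times> 't \<Rightarrow>\<^sub>0 'k) \<Rightarrow> 'k"
  where "cf2 a b t = Poly_Mapping.lookup (tlift (\<lambda>v w. coord v \<otimes>\<^sub>K coord w) t) (a, b)"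

lemma cf2_tensor: "cf2 a b (v \<otimes>\<^sub>K w) = Poly_Mapping.lookup (coord v) a * Poly_Mapping.lookup (coord w) b"
proof -
  have "tlift (\<lambda>v w. coord v \<otimes>\<^sub>K coord w) (v \<otimes>\<^sub>K w) = coord v \<otimes>\<^sub>K coord w"
    by (rule tlift_tensor) (intro klinear_tensor_left klinear_tensor_right klinear_coord)+
  then show ?thesis by (simp add: cf2_def lookup_tensor)
qed

lemma cf2_linear: "cf2 a b (s + t) = cf2 a b s + cf2 a b t" "cf2 a b (scal r t) = r * cf2 a b t"
  "cf2 a b 0 = 0"
  by (simp_all add: cf2_def tlift_add tlift_scal Poly_Mapping.lookup_add
      klinear_zero[OF klinear_tlift[OF klinear_ident]])

lemma cf2_sum: "cf2 a b (sum F A) = (\<Sum>s\<in>A. cf2 a b (F s))"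
  by (induction A rule: infinite_finite_induct) (simp_all add: cf2_linear)

lemma cf2_bidegree:
  assumes "t \<in> bidegree d" "j + l \<noteq> d"
  shows "cf2 (i, j) (k, l) t = 0"
proof -
  have "bidegree d \<subseteq> {t. cf2 (i, j) (k, l) t = 0}"
    unfolding bidegree_def
    by (rule kvec.span_minimal)
       (use assms(2) in \<open>auto simp: kvec.subspace_def cf2_linear cf2_tensor cf_monomial\<close>)
  then show ?thesis using assms(1) by blast
qed

lemma comult_expansion:
  "comult T z = (\<Sum>i<m. \<Sum>j<m. scal (cf i j z) (comult T (monomial i j)))"
  by (subst (1) monomial_expansion[of z])
     (simp add: klinear_sum[OF comult_linear[OF hopf]] comult_linear[OF hopf, unfolded klinear_iff])

text \<open>
  If \<open>d > 0\<close> were the top degree in \<open>x\<close> of \<open>k\<close>, attained at the monomial \<open>h\<^sup>a x\<^sup>d\<close>, then the square of its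
  coefficient would be a coefficient of \<open>k \<otimes> k = \<Delta> k\<close> in degree \<open>2 d > d\<close>, hence zero. So \<open>k\<close> is a
  combination of powers of \<open>h\<close>, and comparing \<open>\<Delta> k\<close> with \<open>k \<otimes> k\<close> shows that its coefficients are
  orthogonal idempotents of the field; exactly one of them is 1.
\<close>

lemma grouplike_eq_h_power:
  assumes comult_k: "comult T k = k \<otimes>\<^sub>K k" and counit_k: "counit T k = 1"
  shows "\<exists>s. k = hpow T h s"
proof -
  let ?D = "{j. j < m \<and> (\<exists>i<m. cf i j k \<noteq> 0)}"
  have degree_0: "cf i j k = 0" if ij: "i < m" "j < m" "j > 0" for i j
  proof (rule ccontr)
    assume "cf i j k \<noteq> 0"
    with ij have j: "j \<in> ?D" by blast
    define d where "d = Max ?D"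
    have "d \<in> ?D" "\<And>j. j \<in> ?D \<Longrightarrow> j \<le> d"
      unfolding d_def using j by (intro Max_in Max_ge; auto)+
    then obtain a where a: "a < m" "cf a d k \<noteq> 0" and max: "\<And>i j. i < m \<Longrightarrow> j < m \<Longrightarrow> j > d \<Longrightarrow> cf i j k = 0"
      by (auto simp: not_less[symmetric])
    have "d > 0" using \<open>\<And>j. j \<in> ?D \<Longrightarrow> j \<le> d\<close>[OF j] ij by simp
    have "cf a d k * cf a d k = cf2 (a, d) (a, d) (comult T k)"
      by (simp add: comult_k cf2_tensor)
    also have "\<dots> = (\<Sum>i<m. \<Sum>j<m. cf i j k * cf2 (a, d) (a, d) (comult T (monomial i j)))"
      by (subst comult_expansion) (simp add: cf2_sum cf2_linear)
    also have "\<dots> = 0"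
    proof (intro sum.neutral ballI)
      fix i j assume ij: "i \<in> {..<m}" "j \<in> {..<m}"
      show "cf i j k * cf2 (a, d) (a, d) (comult T (monomial i j)) = 0"
      proof (cases "j > d")
        case True
        then show ?thesis using max ij by simp
      next
        case False
        then show ?thesis
          using cf2_bidegree[OF comult_monomial, of d d j a a i] \<open>d > 0\<close> by simp
      qed
    qed
    finally show False using a by simp
  qed
  have k: "k = (\<Sum>i<m. scal (cf i 0 k) (hpow T h i))"
  proof -
    have "(\<Sum>j<m. scal (cf i j k) (monomial i j)) = scal (cf i 0 k) (hpow T h i)" if "i < m" for i
    proof -
      have "(\<Sum>j<m. scal (cf i j k) (monomial i j)) =
          (\<Sum>j<m. if j = 0 then scal (cf i 0 k) (hpow T h i) else 0)"
        using that by (intro sum.cong) (auto simp: degree_0 monomial_h_power)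
      then show ?thesis using m_ge_2 by simp
    qed
    then show ?thesis by (subst (1) monomial_expansion[of k]) simp
  qed
  have orthogonal: "cf i 0 k * cf l 0 k = (if i = l then cf i 0 k else 0)" if "i < m" "l < m" for i l
  proof -
    have "cf i 0 k * cf l 0 k = cf2 (i, 0) (l, 0) (comult T k)"
      by (simp add: comult_k cf2_tensor)
    also have "comult T k = (\<Sum>a<m. scal (cf a 0 k) (hpow T h a \<otimes>\<^sub>K hpow T h a))"
      by (subst k) (simp add: klinear_sum[OF comult_linear[OF hopf]] comult_h_power
          comult_linear[OF hopf, unfolded klinear_iff])
    also have "cf2 (i, 0) (l, 0) \<dots> = (\<Sum>a<m. if a = i then (if i = l then cf i 0 k else 0) else 0)"
      unfolding cf2_sum
      by (intro sum.cong) (auto simp: cf2_linear cf2_tensor cf_monomial monomial_h_power[symmetric])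
    finally show ?thesis using that by simp
  qed
  have "k \<noteq> 0"
    using counit_k counit_linear[OF hopf] unfolding klinear_form_iff
    by (metis kvec.scale_zero_left mult_zero_left zero_neq_one)
  then obtain s where s: "s < m" "cf s 0 k \<noteq> 0"
    using k by (metis (no_types, lifting) kvec.scale_zero_left lessThan_iff sum.neutral)
  have "cf s 0 k = 1" using orthogonal[OF s(1,1)] s(2) by simp
  moreover have "cf i 0 k = 0" if "i < m" "i \<noteq> s" for i
    using orthogonal[OF that(1) s(1)] that s(2) by simp
  ultimately have "(\<Sum>i<m. scal (cf i 0 k) (hpow T h i)) = (\<Sum>i<m. if i = s then hpow T h i else 0)"
    by (intro sum.cong) auto
  then show ?thesis using s(1) k by auto
qed

section \<open>Bialgebra endomorphisms of a Taft algebra\<close>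

text \<open>
  A decreasing filtration of \<open>T\<close>, compatible with multiplication and zero from degree \<open>m\<close> on. It bounds the
  nilpotency index of an element by its lowest degree in \<open>x\<close>.
\<close>

definition degree_ge :: "nat \<Rightarrow> ('t \<Rightarrow>\<^sub>0 'k) set"
  where "degree_ge d = kvec.span {monomial i j | i j. j \<ge> d}"

lemma degree_ge_mul:
  assumes "y \<in> degree_ge d" "z \<in> degree_ge e"
  shows "y \<cdot> z \<in> degree_ge (d + e)"
proof -
  have mono: "monomial i j \<cdot> z \<in> degree_ge (d + e)" if "j \<ge> d" for i j
    using assms(2) unfolding degree_ge_def
  proof (rule klinear_maps_span[rotated 2])
    show "klinear (\<lambda>z. monomial i j \<cdot> z)" by (intro mul_klinear_intros)
    fix b assume "b \<in> {monomial i j |i j. e \<le> j}"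
    then obtain k l where b: "b = monomial k l" "e \<le> l" by blast
    have "monomial (i + k) (j + l) \<in> {monomial i j |i j. d + e \<le> j}"
      using add_mono[OF that b(2)] by blast
    then show "monomial i j \<cdot> b \<in> kvec.span {monomial i j |i j. d + e \<le> j}"
      by (simp add: b monomial_mul_monomial kvec.span_scale kvec.span_base)
  qed
  show ?thesis
    using assms(1) unfolding degree_ge_def
  proof (rule klinear_maps_span[rotated 2])
    show "klinear (\<lambda>y. y \<cdot> z)" by (intro mul_klinear_intros)
  qed (use mono in \<open>auto simp: degree_ge_def\<close>)
qed

lemma degree_ge_power: "y \<in> degree_ge d \<Longrightarrow> hpow T y r \<in> degree_ge (r * d)"
proof (induction r)
  case 0
  have "monomial 0 0 \<in> degree_ge 0" unfolding degree_ge_def by (rule kvec.span_base) blast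
  then show ?case by (simp add: monomial_0_0)
next
  case (Suc r)
  then show ?case using degree_ge_mul[of y d "hpow T y r" "r * d"] by simp
qed

lemma degree_ge_zero: "d \<ge> m \<Longrightarrow> y \<in> degree_ge d \<Longrightarrow> y = 0"
  unfolding degree_ge_def
  by (rule klinear_eq_on_span[OF klinear_ident klinear_const_zero]) (auto simp: monomial_ge)

text \<open>
  The factor on the left is the inverse of \<open>h\<^sup>s\<close>, as \<open>h\<^sup>m = 1\<close>, so this is conjugation by a power of \<open>h\<close>.
  It is diagonal in the monomial basis, and its eigenvalues detect the degree in \<open>x\<close>.
\<close>

lemma conj_h_coefficient:
  assumes "i < m" "j < m"
  shows "cf i j (hpow T h ((m - 1) * s) \<cdot> (z \<cdot> hpow T h s)) = q ^ (s * j) * cf i j z"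
proof -
  define K where "K z = hpow T h ((m - 1) * s) \<cdot> (z \<cdot> hpow T h s)" for z
  have lin: "klinear K" unfolding K_def by (intro mul_klinear_intros)
  have "K (monomial a b) = scal (q ^ (s * b)) (monomial a b)" for a b
  proof -
    have "K (monomial a b) = scal (q ^ (s * b)) (monomial ((m - 1) * s + (a + s)) b)"
      by (simp add: K_def monomial_h_power[symmetric] monomial_mul_monomial)
    also have "(m - 1) * s + (a + s) = a + m * s"
      using m_ge_2 by (cases m) auto
    also have "monomial (a + m * s) b = monomial a b"
      by (metis monomial_mod mod_mult_self2)
    finally show ?thesis .
  qed
  then have "K z = (\<Sum>a<m. \<Sum>b<m. scal (cf a b z) (scal (q ^ (s * b)) (monomial a b)))"
    by (subst monomial_expansion[of z]) (simp add: klinear_sum[OF lin] lin[unfolded klinear_iff])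
  then have "cf i j (K z) = (\<Sum>a<m. \<Sum>b<m. cf i j (scal (cf a b z) (scal (q ^ (s * b)) (monomial a b))))"
    by (simp only: klinear_sum[OF klinear_coord] Poly_Mapping.lookup_sum)
  also have "\<dots> = (\<Sum>a<m. \<Sum>b<m. if b = j then if a = i then q ^ (s * j) * cf i j z else 0 else 0)"
    by (intro sum.cong) (auto simp: cf_linear cf_monomial)
  finally have "cf i j (K z) = (\<Sum>a<m. \<Sum>b<m. if b = j then if a = i then q ^ (s * j) * cf i j z else 0 else 0)" .
  then show ?thesis using assms by (simp add: K_def)
qed

text \<open>
  The relation \<open>x h = q h x\<close> transported by \<open>\<phi>\<close> makes \<open>\<phi> x\<close> an eigenvector of conjugation by \<open>\<phi> h = h\<^sup>s\<close>.
  Injectivity of \<open>\<phi>\<close> enters through the nilpotency index: \<open>\<phi> x\<close> must have the same one as \<open>x\<close>, which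
  is \<open>m\<close>, and this is too large for an element of degree at least 2. The form of \<open>\<Delta> x\<close> is used only to
  remove the remaining freedom \<open>x \<mapsto> p(h) x\<close>.
\<close>

lemma bialgebra_endo_form:
  assumes \<phi>: "bialgebra_endo T \<phi>" and inj: "inj \<phi>"
  shows "\<phi> h = h \<and> (\<exists>\<alpha>. \<phi> x = scal \<alpha> x)"
proof -
  have lin: "klinear \<phi>" and one: "\<phi> \<one>\<^sub>T = \<one>\<^sub>T" and mult: "\<And>y z. \<phi> (y \<cdot> z) = \<phi> y \<cdot> \<phi> z"
    and comult: "\<And>z. comult T (\<phi> z) = tlift (\<lambda>z1 z2. \<phi> z1 \<otimes>\<^sub>K \<phi> z2) (comult T z)"
    and counit: "\<And>z. counit T (\<phi> z) = counit T z"
    using \<phi> by (auto simp: bialgebra_endo_def)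
  have comult_tensor: "tlift (\<lambda>z1 z2. \<phi> z1 \<otimes>\<^sub>K \<phi> z2) (v \<otimes>\<^sub>K w) = \<phi> v \<otimes>\<^sub>K \<phi> w" for v w
    by (rule tlift_tensor) (intro klinear_tensor_left klinear_tensor_right lin)+
  have zero_iff: "\<phi> z = 0 \<longleftrightarrow> z = 0" for z
    using inj klinear_zero[OF lin] by (metis injD)
  have pow: "\<phi> (hpow T z r) = hpow T (\<phi> z) r" for z r
    by (induction r) (simp_all add: one mult)
  obtain s where s: "\<phi> h = hpow T h s"
    using grouplike_eq_h_power[of "\<phi> h"] by (auto simp: comult comult_h comult_tensor counit counit_h)
  define y where "y = \<phi> x"
  have "y \<cdot> hpow T h s = scal q (hpow T h s \<cdot> y)"
    using arg_cong[OF x_mul_h, of \<phi>] lin by (simp add: mult klinear_iff y_def s)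
  then have "hpow T h ((m - 1) * s) \<cdot> (y \<cdot> hpow T h s) = scal q ((hpow T h ((m - 1) * s) \<cdot> hpow T h s) \<cdot> y)"
    by (simp add: mul_assoc)
  also have "hpow T h ((m - 1) * s) \<cdot> hpow T h s = hpow T h (m * s)"
    using m_ge_2 by (simp add: pow_add[symmetric] algebra_simps)
  also have "hpow T h (m * s) = \<one>\<^sub>T"
    using h_power_mod[of "m * s"] by simp
  finally have conj: "hpow T h ((m - 1) * s) \<cdot> (y \<cdot> hpow T h s) = scal q y" by simp
  \<comment> \<open>Every monomial in \<open>y\<close> lies in the same eigenspace of conjugation by \<open>h\<^sup>s\<close> as \<open>y\<close>.\<close>
  have weight: "q ^ (s * j) = q" if "i < m" "j < m" "cf i j y \<noteq> 0" for i j
    using conj_h_coefficient[OF that(1,2), of s y] that(3) unfolding conj by (simp add: cf_linear)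
  have "\<exists>i<m. cf i 1 y \<noteq> 0"
  proof (rule ccontr)
    assume no: "\<not> ?thesis"
    have "cf i j y = 0" if "i < m" "j < 2" for i j
    proof (cases "j = 0")
      case True
      have "q \<noteq> 1" using q_power_eq_q[of 0] m_ge_2 by auto
      then show ?thesis using weight[of i j] that True m_ge_2 by fastforce
    next
      case False
      then have "j = 1" using that by simp
      then show ?thesis using no that by blast
    qed
    then have "y = (\<Sum>i<m. \<Sum>j<m. if j < 2 then 0 else scal (cf i j y) (monomial i j))"
      by (subst monomial_expansion[of y]) (intro sum.cong, auto)
    moreover have "(\<Sum>i<m. \<Sum>j<m. if j < 2 then 0 else scal (cf i j y) (monomial i j)) \<in> degree_ge 2"
    proof -
      have "monomial i j \<in> degree_ge 2" if "\<not> j < 2" for i j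
        unfolding degree_ge_def by (rule kvec.span_base) (use that in force)
      then show ?thesis
        unfolding degree_ge_def by (intro kvec.span_sum) (auto simp: kvec.span_zero kvec.span_scale)
    qed
    \<comment> \<open>Here \<open>2 (m - 1) \<ge> m\<close> is what makes the power vanish.\<close>
    ultimately have "y \<in> degree_ge 2" by simp
    from degree_ge_power[OF this, of "m - 1"] have "hpow T y (m - 1) = 0"
      by (rule degree_ge_zero[rotated]) (use m_ge_2 in simp)
    then have "hpow T x (m - 1) = 0"
      by (simp add: y_def pow[symmetric] zero_iff)
    then show False using x_power_nonzero[of "m - 1"] m_ge_2 by simp
  qed
  then obtain i where "i < m" "cf i 1 y \<noteq> 0" by blast
  then have qs: "q ^ s = q" using weight[of i 1] m_ge_2 by simp
  then have "s mod m = 1" by (simp add: q_power_eq_q)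
  then have \<phi>h: "\<phi> h = h" using h_power_mod[of s] by (simp add: s)
  have degree_1: "cf i j y = 0" if "i < m" "j < m" "j \<noteq> 1" for i j
  proof (rule ccontr)
    assume "cf i j y \<noteq> 0"
    from weight[OF that(1,2) this] have "q ^ j = q" by (simp add: power_mult qs)
    then show False using that by (simp add: q_power_eq_q)
  qed
  have comult_y: "comult T y = y \<otimes>\<^sub>K h + \<one>\<^sub>T \<otimes>\<^sub>K y"
    by (simp add: y_def comult comult_x tlift_add comult_tensor \<phi>h one)
  have cf_y: "cf a 1 y = 0" if "a < m" "a \<noteq> 0" for a
  proof -
    have y: "y = (\<Sum>i<m. scal (cf i 1 y) (hpow T h i \<cdot> x))"
    proof -
      have "(\<Sum>j<m. scal (cf i j y) (monomial i j)) = (\<Sum>j<m. if j = 1 then scal (cf i 1 y) (hpow T h i \<cdot> x) else 0)"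
        if "i < m" for i
        using that degree_1 by (intro sum.cong) (auto simp: monomial_def)
      then have "(\<Sum>j<m. scal (cf i j y) (monomial i j)) = scal (cf i 1 y) (hpow T h i \<cdot> x)"
        if "i < m" for i
        using that m_ge_2 by simp
      then show ?thesis by (subst (1) monomial_expansion[of y]) simp
    qed
    have comult_hx: "comult T (hpow T h i \<cdot> x) =
        monomial i 1 \<otimes>\<^sub>K monomial (Suc i) 0 + monomial i 0 \<otimes>\<^sub>K monomial i 1" for i
    proof -
      have "comult T (hpow T h i \<cdot> x) = tlift (\<lambda>b1 b2. hpow T h i \<cdot> b1 \<otimes>\<^sub>K hpow T h i \<cdot> b2) (x \<otimes>\<^sub>K h)
          + tlift (\<lambda>b1 b2. hpow T h i \<cdot> b1 \<otimes>\<^sub>K hpow T h i \<cdot> b2) (\<one>\<^sub>T \<otimes>\<^sub>K x)"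
        by (simp add: comult_hmul_tensor[OF hopf comult_h_power] comult_x tlift_add)
      also have "\<dots> = hpow T h i \<cdot> x \<otimes>\<^sub>K hpow T h i \<cdot> h + hpow T h i \<cdot> \<one>\<^sub>T \<otimes>\<^sub>K hpow T h i \<cdot> x"
        by (intro arg_cong2[where f = "(+)"] tlift_tensor) (intro mul_klinear_intros)+
      also have "hpow T h i \<cdot> h = hpow T h (Suc i)"
        using pow_add[of h i 1] by simp
      finally show ?thesis by (simp add: monomial_def)
    qed
    \<comment> \<open>In \<open>\<Delta> y\<close> the term \<open>h\<^sup>a x \<otimes> h\<^sup>a\<^sup>+\<^sup>1\<close> comes only from \<open>h\<^sup>a x\<close>; in \<open>y \<otimes> h + 1 \<otimes> y\<close> it is missing unless \<open>a = 0\<close>.\<close>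
    let ?b = "(Suc a mod m, 0)"
    have "cf2 (a, 1) ?b (comult T y) =
        (\<Sum>i<m. cf i 1 y * cf2 (a, 1) ?b (comult T (hpow T h i \<cdot> x)))"
      by (subst (1) y) (simp add: klinear_sum[OF comult_linear[OF hopf]] cf2_sum cf2_linear
          comult_linear[OF hopf, unfolded klinear_iff])
    also have "\<dots> = (\<Sum>i<m. if i = a then cf a 1 y else 0)"
      using m_ge_2 by (intro sum.cong) (auto simp: comult_hx cf2_linear cf2_tensor cf_monomial)
    finally have cf2_y: "cf2 (a, 1) ?b (comult T y) = cf a 1 y" using that by simp
    have "Suc a mod m \<noteq> 1"
      using that by (cases "Suc a = m") auto
    then have "cf (Suc a mod m) 0 h = 0"
      using m_ge_2 cf_monomial[of 1 0 "Suc a mod m" 0, unfolded monomial_1_0] by auto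
    moreover have "cf a 1 \<one>\<^sub>T = 0"
      using cf_monomial[of 0 0 a 1, unfolded monomial_0_0] by simp
    ultimately have "cf2 (a, 1) ?b (comult T y) = 0"
      by (simp add: comult_y cf2_linear cf2_tensor)
    with cf2_y show ?thesis by simp
  qed
  have "y = scal (cf 0 1 y) x"
  proof (rule cf_eqI)
    fix i j assume "i < m" "j < m"
    then show "cf i j y = cf i j (scal (cf 0 1 y) x)"
      using cf_monomial[of 0 1 i j, unfolded monomial_0_1] degree_1 cf_y
      by (cases "j = 1"; cases "i = 0") (auto simp: cf_linear monomial_0_1)
  qed
  then show ?thesis using \<phi>h y_def by blast
qed

end

section \<open>Maps out of a tensor product with a group Hopf algebra\<close>

text \<open>
  Comparing the coefficients in the row of an index at which \<open>v\<close> does not vanish.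
\<close>

lemma tensor_proportional:
  assumes "v \<otimes>\<^sub>K w = v' \<otimes>\<^sub>K w'" "v \<noteq> 0"
  shows "\<exists>r. w = scal r w'"
proof -
  obtain i where i: "Poly_Mapping.lookup v i \<noteq> 0"
    using assms(2) by (metis lookup_zero poly_mapping_eqI)
  have "Poly_Mapping.lookup v i * Poly_Mapping.lookup w j =
      Poly_Mapping.lookup v' i * Poly_Mapping.lookup w' j" for j
    using assms(1) by (metis lookup_tensor)
  then have "w = scal (Poly_Mapping.lookup v' i / Poly_Mapping.lookup v i) w'"
    using i by (intro poly_mapping_eqI) (simp add: field_simps)
  then show ?thesis ..
qed

lemma tensor_eq_zero: "v \<otimes>\<^sub>K w = 0 \<longleftrightarrow> v = 0 \<or> w = 0"
proof
  assume "v \<otimes>\<^sub>K w = 0"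
  then have "v \<noteq> 0 \<Longrightarrow> \<exists>r. w = scal r 0"
    using tensor_proportional[of v w 0 0] by simp
  then show "v = 0 \<or> w = 0" by auto
qed auto

locale group_hopf =
  fixes G :: "('g, 'w) monoid_scheme" (structure)
    and H :: "('c, 'k::field) hopf" and u :: "'g \<Rightarrow> ('c \<Rightarrow>\<^sub>0 'k)"
  assumes group_hopf: "group_hopf_algebra G H u"
begin

lemma G_group: "group G" and H_hopf: "hopf_algebra H"
  and u_inj: "inj_on u (carrier G)"
  and u_independent: "kvec.independent (u ` carrier G)"
  and u_span: "kvec.span (u ` carrier G) = UNIV"
  and u_mult: "a \<in> carrier G \<Longrightarrow> b \<in> carrier G \<Longrightarrow> hmul H (u a) (u b) = u (a \<otimes> b)"
  and u_one: "hone H = u \<one>"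
  and comult_u: "a \<in> carrier G \<Longrightarrow> comult H (u a) = u a \<otimes>\<^sub>K u a"
  and counit_u: "a \<in> carrier G \<Longrightarrow> counit H (u a) = 1"
  using group_hopf by (auto simp: group_hopf_algebra_def)

sublocale group G by (rule G_group)

lemma klinear_eq_on_group:
  assumes "klinear f" "klinear f'" "\<And>a. a \<in> carrier G \<Longrightarrow> f (u a) = f' (u a)"
  shows "f y = f' y"
  by (rule klinear_eq_on_span[OF assms(1,2), of "u ` carrier G"]) (use assms(3) u_span in auto)

lemma klinear_eq_on_group_tensors:
  assumes f: "klinear f" "klinear f'"
    and eq: "\<And>a z. a \<in> carrier G \<Longrightarrow> f (u a \<otimes>\<^sub>K z) = f' (u a \<otimes>\<^sub>K z)"
  shows "f t = f' t"
proof (rule klinear_eq_on_tensors[OF f])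
  show "f (y \<otimes>\<^sub>K z) = f' (y \<otimes>\<^sub>K z)" for y z
    by (rule klinear_eq_on_group[of "\<lambda>y. f (y \<otimes>\<^sub>K z)" "\<lambda>y. f' (y \<otimes>\<^sub>K z)"])
       (rule eq klinear_comp[OF f(1)] klinear_comp[OF f(2)] klinear_tensor_left klinear_ident | assumption)+
qed

lemma klinear_form_eq_on_group_tensors:
  fixes f :: "('c \<times> 'i \<Rightarrow>\<^sub>0 'k) \<Rightarrow> 'k"
  assumes "klinear_form f" "klinear_form f'"
    and eq: "\<And>a z. a \<in> carrier G \<Longrightarrow> f (u a \<otimes>\<^sub>K z) = f' (u a \<otimes>\<^sub>K z)"
  shows "f t = f' t"
proof -
  have "scal (f t) (unit_vec ()) = scal (f' t) (unit_vec ())"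
    by (rule klinear_eq_on_group_tensors[of "\<lambda>t. scal (f t) (unit_vec ())" "\<lambda>t. scal (f' t) (unit_vec ())"])
       (auto intro: klinear_scal_form klinear_ident assms)
  then have "Poly_Mapping.lookup (scal (f t) (unit_vec ())) () = Poly_Mapping.lookup (scal (f' t) (unit_vec ())) ()"
    by (rule arg_cong)
  then show ?thesis by (simp only: lookup_scal) (simp add: lookup_unit_vec)
qed

text \<open>
  The group elements are a basis of the group Hopf algebra, so a linear map on \<open>K[G] \<otimes> V\<close> may be
  prescribed by one linear map on \<open>V\<close> for each group element.
\<close>

lemma ex_linear_on_group_tensors:
  fixes F :: "'g \<Rightarrow> ('i \<Rightarrow>\<^sub>0 'k) \<Rightarrow> ('j \<Rightarrow>\<^sub>0 'k)"
  assumes F: "\<And>a. klinear (F a)"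
  shows "\<exists>L. klinear L \<and> (\<forall>a\<in>carrier G. \<forall>z. L (u a \<otimes>\<^sub>K z) = F a z)"
proof -
  have "\<exists>\<kappa>. klinear \<kappa> \<and> (\<forall>y\<in>u ` carrier G. \<kappa> y = (unit_vec (inv_into (carrier G) u y) :: 'g \<Rightarrow>\<^sub>0 'k))"
    by (rule vector_space_pair.linear_independent_extend[OF _ u_independent])
       (rule vector_space_pair.intro[OF vector_space_scal vector_space_scal])
  then obtain \<kappa> :: "('c \<Rightarrow>\<^sub>0 'k) \<Rightarrow> ('g \<Rightarrow>\<^sub>0 'k)"
    where lin: "klinear \<kappa>" and \<kappa>: "\<And>a. a \<in> carrier G \<Longrightarrow> \<kappa> (u a) = unit_vec a"
    using u_inj by (auto simp: inv_into_f_f)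
  let ?L = "tlift (\<lambda>y z. linear_extension (\<lambda>a. F a z) (\<kappa> y))"
  have "?L (y \<otimes>\<^sub>K z) = linear_extension (\<lambda>a. F a z) (\<kappa> y)" for y z
  proof (rule tlift_tensor)
    show "klinear (\<lambda>y. linear_extension (\<lambda>a. F a z) (\<kappa> y))" for z
      by (rule klinear_comp[OF klinear_linear_extension lin])
    show "klinear (\<lambda>z. linear_extension (\<lambda>a. F a z) (\<kappa> y))" for y
      unfolding linear_extension_def by (intro klinear_sum_fun klinear_scal F)
  qed
  moreover have "klinear ?L" by (rule klinear_tlift[OF klinear_ident])
  ultimately show ?thesis by (intro exI[of _ ?L]) (simp add: \<kappa>)
qed

lemma tlift_comult_u:
  assumes "a \<in> carrier G" "\<And>z. klinear (\<lambda>y. \<beta> y z)" "\<And>y. klinear (\<beta> y)"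
  shows "tlift \<beta> (comult H (u a)) = \<beta> (u a) (u a)"
  unfolding comult_u[OF assms(1)] by (rule tlift_tensor[OF assms(2,3)])

lemma comult_tensor_coalg_u:
  assumes A: "hopf_algebra A" and a: "a \<in> carrier G"
  shows "comult (tensor_coalg H A) (u a \<otimes>\<^sub>K z) =
    tlift (\<lambda>z1 z2. (u a \<otimes>\<^sub>K z1) \<otimes>\<^sub>K (u a \<otimes>\<^sub>K z2)) (comult A z)"
proof -
  have "comult (tensor_coalg H A) (u a \<otimes>\<^sub>K z) =
      tlift (\<lambda>c1 c2. tlift (\<lambda>d1 d2. (c1 \<otimes>\<^sub>K d1) \<otimes>\<^sub>K (c2 \<otimes>\<^sub>K d2)) (comult A z)) (comult H (u a))"
    unfolding tensor_coalg_def coalg.simps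
    by (rule tlift_tensor) (intro klinear_intros klinear_comult[OF A] klinear_comult[OF H_hopf])+
  also have "\<dots> = tlift (\<lambda>z1 z2. (u a \<otimes>\<^sub>K z1) \<otimes>\<^sub>K (u a \<otimes>\<^sub>K z2)) (comult A z)"
    by (rule tlift_comult_u[OF a]) (intro klinear_intros)+
  finally show ?thesis .
qed

lemma counit_tensor_coalg_u:
  assumes A: "hopf_algebra A" and a: "a \<in> carrier G"
  shows "counit (tensor_coalg H A) (u a \<otimes>\<^sub>K z) = counit A z"
proof -
  have "counit (tensor_coalg H A) (u a \<otimes>\<^sub>K z) = counit H (u a) * counit A z"
    unfolding tensor_coalg_def coalg.simps
    by (rule tlift_form_tensor)
       (use counit_linear[OF A] counit_linear[OF H_hopf] in \<open>simp_all add: klinear_form_iff algebra_simps\<close>)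
  then show ?thesis by (simp add: counit_u[OF a])
qed

text \<open>
  Being a coalgebra map on \<open>K[G] \<otimes> A\<close> can be tested at \<open>a \<otimes> z\<close> for group elements \<open>a\<close>; as \<open>a\<close> is
  group-like, it means that \<open>z \<mapsto> f (a \<otimes> z)\<close> is a coalgebra map for each \<open>a\<close>.
\<close>

lemma coalgebra_map_iff:
  fixes f :: "('c \<times> 'i \<Rightarrow>\<^sub>0 'k) \<Rightarrow> ('j \<Rightarrow>\<^sub>0 'k)"
  assumes A: "hopf_algebra A" and D: "hopf_algebra D"
  shows "coalgebra_map (tensor_coalg H A) D f \<longleftrightarrow> klinear f \<and>
    (\<forall>a\<in>carrier G. \<forall>z. comult D (f (u a \<otimes>\<^sub>K z)) =
        tlift (\<lambda>z1 z2. f (u a \<otimes>\<^sub>K z1) \<otimes>\<^sub>K f (u a \<otimes>\<^sub>K z2)) (comult A z)) \<and>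
    (\<forall>a\<in>carrier G. \<forall>z. counit D (f (u a \<otimes>\<^sub>K z)) = counit A z)"
proof (cases "klinear f")
  case False
  then show ?thesis by (simp add: coalgebra_map_def)
next
  case True
  let ?C = "tensor_coalg H A"
  have C: "klinear (comult ?C)" "klinear_form (counit ?C)"
    unfolding tensor_coalg_def coalg.simps
    by (rule klinear_tlift[OF klinear_ident] klinear_form_tlift_form)+
  have ff: "tlift (\<lambda>c1 c2. f c1 \<otimes>\<^sub>K f c2) (comult ?C (u a \<otimes>\<^sub>K z)) =
      tlift (\<lambda>z1 z2. f (u a \<otimes>\<^sub>K z1) \<otimes>\<^sub>K f (u a \<otimes>\<^sub>K z2)) (comult A z)" if "a \<in> carrier G" for a z
  proof -
    have "tlift (\<lambda>c1 c2. f c1 \<otimes>\<^sub>K f c2) (c \<otimes>\<^sub>K d) = f c \<otimes>\<^sub>K f d" for c d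
      by (rule tlift_tensor) (intro klinear_tensor_left klinear_tensor_right True)+
    then show ?thesis
      unfolding comult_tensor_coalg_u[OF A that] klinear_of_tlift[OF klinear_tlift[OF klinear_ident]]
      by simp
  qed
  have "(\<forall>c. comult D (f c) = tlift (\<lambda>c1 c2. f c1 \<otimes>\<^sub>K f c2) (comult ?C c)) \<longleftrightarrow>
      (\<forall>a\<in>carrier G. \<forall>z. comult D (f (u a \<otimes>\<^sub>K z)) =
        tlift (\<lambda>z1 z2. f (u a \<otimes>\<^sub>K z1) \<otimes>\<^sub>K f (u a \<otimes>\<^sub>K z2)) (comult A z))" (is "?l \<longleftrightarrow> ?r")
  proof
    assume ?l
    then show ?r by (simp add: ff)
  next
    assume r: ?r
    show ?l
    proof
      fix c
      show "comult D (f c) = tlift (\<lambda>c1 c2. f c1 \<otimes>\<^sub>K f c2) (comult ?C c)"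
      proof (rule klinear_eq_on_group_tensors[of "\<lambda>c. comult D (f c)"
            "\<lambda>c. tlift (\<lambda>c1 c2. f c1 \<otimes>\<^sub>K f c2) (comult ?C c)"])
        fix a and z assume a: "a \<in> carrier G"
        show "comult D (f (u a \<otimes>\<^sub>K z)) =
            tlift (\<lambda>c1 c2. f c1 \<otimes>\<^sub>K f c2) (comult ?C (u a \<otimes>\<^sub>K z))"
          unfolding ff[OF a] using r a by blast
      qed (rule klinear_comult[OF D True] klinear_tlift[OF C(1)])+
    qed
  qed
  moreover have "(\<forall>c. counit D (f c) = counit ?C c) \<longleftrightarrow>
      (\<forall>a\<in>carrier G. \<forall>z. counit D (f (u a \<otimes>\<^sub>K z)) = counit A z)" (is "?l \<longleftrightarrow> ?r")
  proof
    assume ?l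
    then show ?r by (simp add: counit_tensor_coalg_u[OF A])
  next
    assume r: ?r
    show ?l
    proof
      fix c
      show "counit D (f c) = counit ?C c"
      proof (rule klinear_form_eq_on_group_tensors[of "\<lambda>c. counit D (f c)" "counit ?C"])
        show "klinear_form (\<lambda>c. counit D (f c))"
          using True counit_linear[OF D] by (simp add: klinear_form_iff klinear_iff)
        fix a and z assume a: "a \<in> carrier G"
        show "counit D (f (u a \<otimes>\<^sub>K z)) = counit ?C (u a \<otimes>\<^sub>K z)"
          unfolding counit_tensor_coalg_u[OF A a] using r a by blast
      qed (rule C)
    qed
  qed
  ultimately show ?thesis using True by (simp add: coalgebra_map_def)
qed

section \<open>Matched pairs with trivial right action\<close>

text \<open>
  A group acting on \<open>A\<close> by bialgebra endomorphisms turns \<open>A\<close> into a module algebra and module coalgebra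
  over \<open>K[G]\<close>, the situation of a smash product. By linearity each axiom is checked at group elements,
  where the Sweedler sums over \<open>K[G]\<close> have one term; in those over \<open>A\<close> the trivial right action
  contributes a factor \<open>\<epsilon>\<close>, and the counit law collapses them. The compatibility axiom is the equality of
  the left and the right counit law.
\<close>

lemma matched_pair_trivial_right:
  fixes A :: "('i, 'k) hopf"
  assumes A: "hopf_algebra A"
    and \<phi>: "\<And>a. a \<in> carrier G \<Longrightarrow> bialgebra_endo A (\<phi> a)"
    and \<phi>_one: "\<And>z. \<phi> \<one> z = z"
    and \<phi>_mult: "\<And>a b z. a \<in> carrier G \<Longrightarrow> b \<in> carrier G \<Longrightarrow> \<phi> (a \<otimes> b) z = \<phi> a (\<phi> b z)"
    and L: "klinear L" "\<And>a z. a \<in> carrier G \<Longrightarrow> L (u a \<otimes>\<^sub>K z) = \<phi> a z"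
    and R: "klinear R" "\<And>y z. R (y \<otimes>\<^sub>K z) = scal (counit A z) y"
  shows "matched_pair A H R L"
proof -
  note Aun = hopf_unital[OF A] and Hun = hopf_unital[OF H_hopf]
  note AH = hmul_bilinear[OF Aun] hmul_bilinear[OF Hun]
  note lins = klinear_intros klinear_comult[OF A] klinear_comult[OF H_hopf]
    klinear_hmul_left[OF hmult_linear[OF Aun]] klinear_hmul_right[OF hmult_linear[OF Aun]]
    klinear_hmul_left[OF hmult_linear[OF Hun]] klinear_hmul_right[OF hmult_linear[OF Hun]]
    klinear_comp[OF L(1)] klinear_comp[OF R(1)]
    klinear_scal_form[OF counit_linear[OF A]] klinear_scal_form[OF counit_linear[OF H_hopf]]
  have \<phi>_lin: "klinear (\<phi> a)" and \<phi>_hone: "\<phi> a (hone A) = hone A"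
    and \<phi>_hmul: "\<phi> a (hmul A y z) = hmul A (\<phi> a y) (\<phi> a z)"
    and \<phi>_comult: "comult A (\<phi> a z) = tlift (\<lambda>z1 z2. \<phi> a z1 \<otimes>\<^sub>K \<phi> a z2) (comult A z)"
    and \<phi>_counit: "counit A (\<phi> a z) = counit A z"
    if "a \<in> carrier G" for a y z
    using \<phi>[OF that] by (auto simp: bialgebra_endo_def)
  have \<epsilon>_scal: "counit A (scal r z) = r * counit A z" for r z
    using counit_linear[OF A] by (simp add: klinear_form_iff)
  have \<epsilon>H_scal: "counit H (scal r y) = r * counit H y" for r y
    using counit_linear[OF H_hopf] by (simp add: klinear_form_iff)
  have \<Delta>H_scal: "comult H (scal r y) = scal r (comult H y)" for r y
    using comult_linear[OF H_hopf] by (simp add: klinear_iff)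
  have L_scal: "L (scal r t) = scal r (L t)" for r t
    using L(1) by (simp add: klinear_iff)
  have sweedler_left: "tlift (\<lambda>z1 z2. M (scal (counit A z1) z2)) (comult A z) = M z"
    and sweedler_right: "tlift (\<lambda>z1 z2. M (scal (counit A z2) z1)) (comult A z) = M z"
    if "klinear M" for M :: "('i \<Rightarrow>\<^sub>0 'k) \<Rightarrow> ('j \<Rightarrow>\<^sub>0 'k)" and z
    using klinear_of_tlift[OF that, of "\<lambda>c1 c2. scal (counit A c1) c2" "comult A z"]
      klinear_of_tlift[OF that, of "\<lambda>c1 c2. scal (counit A c2) c1" "comult A z"]
    by (simp_all add: counit_left[OF A] counit_right[OF A])
  have "coalgebra_map (tensor_coalg H A) H R"
    unfolding coalgebra_map_iff[OF A H_hopf] R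
  proof (intro conjI ballI allI)
    fix a and z assume a: "a \<in> carrier G"
    have "tlift (\<lambda>z1 z2. scal (counit A z1) (u a) \<otimes>\<^sub>K scal (counit A z2) (u a)) (comult A z)
        = tlift (\<lambda>z1 z2. scal (counit A (scal (counit A z1) z2)) (u a \<otimes>\<^sub>K u a)) (comult A z)"
      by (simp add: tensor_scal_left tensor_scal_right \<epsilon>_scal mult.commute)
    also have "\<dots> = scal (counit A z) (u a \<otimes>\<^sub>K u a)"
      by (rule sweedler_left) (intro lins)
    finally show "comult H (scal (counit A z) (u a)) =
        tlift (\<lambda>z1 z2. scal (counit A z1) (u a) \<otimes>\<^sub>K scal (counit A z2) (u a)) (comult A z)"
      by (simp add: \<Delta>H_scal comult_u[OF a])
  qed (simp_all add: R \<epsilon>H_scal counit_u)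
  moreover have "coalgebra_map (tensor_coalg H A) A L"
    unfolding coalgebra_map_iff[OF A A] by (simp add: L \<phi>_comult \<phi>_counit)
  moreover have "left_module_action H L"
    unfolding left_module_action_def
  proof (intro conjI allI)
    show "klinear L" by (rule L)
    show "L (hone H \<otimes>\<^sub>K z) = z" for z by (simp add: u_one L(2) \<phi>_one)
    have "L (hmul H (u a) y \<otimes>\<^sub>K z) = L (u a \<otimes>\<^sub>K L (y \<otimes>\<^sub>K z))" if a: "a \<in> carrier G" for a y z
    proof (rule klinear_eq_on_group[of "\<lambda>y. L (hmul H (u a) y \<otimes>\<^sub>K z)"])
      fix b assume "b \<in> carrier G"
      then show "L (hmul H (u a) (u b) \<otimes>\<^sub>K z) = L (u a \<otimes>\<^sub>K L (u b \<otimes>\<^sub>K z))"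
        using a by (simp add: u_mult L(2) \<phi>_mult)
    qed (intro lins)+
    note on_group = this
    show "L (hmul H y y' \<otimes>\<^sub>K z) = L (y \<otimes>\<^sub>K L (y' \<otimes>\<^sub>K z))" for y y' z
      by (rule klinear_eq_on_group[of "\<lambda>y. L (hmul H y y' \<otimes>\<^sub>K z)"]) (intro lins | rule on_group)+
  qed
  moreover have "right_module_action A R"
    by (simp add: right_module_action_def R counit_hone[OF A] counit_hmul[OF A] mult.commute)
  moreover have "L (y \<otimes>\<^sub>K hone A) = scal (counit H y) (hone A)" for y
    by (rule klinear_eq_on_group[of "\<lambda>y. L (y \<otimes>\<^sub>K hone A)" "\<lambda>y. scal (counit H y) (hone A)"])
       (auto intro!: lins simp: L(2) \<phi>_hone counit_u)
  moreover have "R (hone H \<otimes>\<^sub>K z) = scal (counit A z) (hone H)" for z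
    by (rule R)
  moreover have "L (y \<otimes>\<^sub>K hmul A z w) =
       tlift (\<lambda>y1 y2. tlift (\<lambda>a1 a2. hmul A (L (y1 \<otimes>\<^sub>K a1)) (L (R (y2 \<otimes>\<^sub>K a2) \<otimes>\<^sub>K w)))
         (comult A z)) (comult H y)" for y z w
  proof (rule klinear_eq_on_group[of "\<lambda>y. L (y \<otimes>\<^sub>K hmul A z w)"])
    fix a assume a: "a \<in> carrier G"
    have "tlift (\<lambda>y1 y2. tlift (\<lambda>a1 a2. hmul A (L (y1 \<otimes>\<^sub>K a1)) (L (R (y2 \<otimes>\<^sub>K a2) \<otimes>\<^sub>K w)))
         (comult A z)) (comult H (u a)) =
       tlift (\<lambda>a1 a2. hmul A (L (u a \<otimes>\<^sub>K a1)) (L (R (u a \<otimes>\<^sub>K a2) \<otimes>\<^sub>K w))) (comult A z)"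
      by (rule tlift_comult_u[OF a]) (intro lins)+
    also have "\<dots> = tlift (\<lambda>a1 a2. hmul A (L (u a \<otimes>\<^sub>K scal (counit A a2) a1)) (\<phi> a w)) (comult A z)"
      by (simp add: R(2) tensor_scal_left tensor_scal_right L_scal L(2)[OF a] AH)
    also have "\<dots> = hmul A (L (u a \<otimes>\<^sub>K z)) (\<phi> a w)"
      by (rule sweedler_right) (intro lins)
    also have "\<dots> = L (u a \<otimes>\<^sub>K hmul A z w)"
      by (simp add: L(2)[OF a] \<phi>_hmul[OF a])
    finally show "L (u a \<otimes>\<^sub>K hmul A z w) =
       tlift (\<lambda>y1 y2. tlift (\<lambda>a1 a2. hmul A (L (y1 \<otimes>\<^sub>K a1)) (L (R (y2 \<otimes>\<^sub>K a2) \<otimes>\<^sub>K w)))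
         (comult A z)) (comult H (u a))" ..
  qed (intro lins)+
  moreover have "R (hmul H y y' \<otimes>\<^sub>K z) =
       tlift (\<lambda>z1 z2. tlift (\<lambda>a1 a2. hmul H (R (y \<otimes>\<^sub>K L (z1 \<otimes>\<^sub>K a1))) (R (z2 \<otimes>\<^sub>K a2)))
         (comult A z)) (comult H y')" for y y' z
  proof (rule klinear_eq_on_group[of "\<lambda>y'. R (hmul H y y' \<otimes>\<^sub>K z)"])
    fix a assume a: "a \<in> carrier G"
    have "tlift (\<lambda>z1 z2. tlift (\<lambda>a1 a2. hmul H (R (y \<otimes>\<^sub>K L (z1 \<otimes>\<^sub>K a1))) (R (z2 \<otimes>\<^sub>K a2)))
         (comult A z)) (comult H (u a)) =
       tlift (\<lambda>a1 a2. hmul H (R (y \<otimes>\<^sub>K L (u a \<otimes>\<^sub>K a1))) (R (u a \<otimes>\<^sub>K a2))) (comult A z)"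
      by (rule tlift_comult_u[OF a]) (intro lins)+
    also have "\<dots> = tlift (\<lambda>a1 a2. R (hmul H y (u a) \<otimes>\<^sub>K scal (counit A a1) a2)) (comult A z)"
      by (simp add: R(2) L(2)[OF a] \<phi>_counit[OF a] AH \<epsilon>_scal mult.commute)
    also have "\<dots> = R (hmul H y (u a) \<otimes>\<^sub>K z)"
      by (rule sweedler_left) (intro lins)
    finally show "R (hmul H y (u a) \<otimes>\<^sub>K z) =
       tlift (\<lambda>z1 z2. tlift (\<lambda>a1 a2. hmul H (R (y \<otimes>\<^sub>K L (z1 \<otimes>\<^sub>K a1))) (R (z2 \<otimes>\<^sub>K a2)))
         (comult A z)) (comult H (u a))" ..
  qed (intro lins)+
  moreover have "tlift (\<lambda>y1 y2. tlift (\<lambda>a1 a2. R (y1 \<otimes>\<^sub>K a1) \<otimes>\<^sub>K L (y2 \<otimes>\<^sub>K a2)) (comult A z)) (comult H y)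
     = tlift (\<lambda>y1 y2. tlift (\<lambda>a1 a2. R (y2 \<otimes>\<^sub>K a2) \<otimes>\<^sub>K L (y1 \<otimes>\<^sub>K a1)) (comult A z)) (comult H y)"
    (is "?l y = ?r y") for y z
  proof (rule klinear_eq_on_group[of ?l ?r])
    fix a assume a: "a \<in> carrier G"
    have "?l (u a) = tlift (\<lambda>a1 a2. R (u a \<otimes>\<^sub>K a1) \<otimes>\<^sub>K L (u a \<otimes>\<^sub>K a2)) (comult A z)"
      by (rule tlift_comult_u[OF a]) (intro lins)+
    also have "\<dots> = tlift (\<lambda>a1 a2. u a \<otimes>\<^sub>K L (u a \<otimes>\<^sub>K scal (counit A a1) a2)) (comult A z)"
      by (simp add: R(2) tensor_scal_left tensor_scal_right L_scal)
    also have "\<dots> = u a \<otimes>\<^sub>K L (u a \<otimes>\<^sub>K z)"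
      by (rule sweedler_left) (intro lins)
    also have "\<dots> = tlift (\<lambda>a1 a2. u a \<otimes>\<^sub>K L (u a \<otimes>\<^sub>K scal (counit A a2) a1)) (comult A z)"
      by (rule sweedler_right[symmetric]) (intro lins)
    also have "\<dots> = tlift (\<lambda>a1 a2. R (u a \<otimes>\<^sub>K a2) \<otimes>\<^sub>K L (u a \<otimes>\<^sub>K a1)) (comult A z)"
      by (simp add: R(2) tensor_scal_left tensor_scal_right L_scal)
    also have "\<dots> = ?r (u a)"
      by (rule tlift_comult_u[OF a, symmetric]) (intro lins)+
    finally show "?l (u a) = ?r (u a)" .
  qed (intro lins)+
  ultimately show ?thesis
    unfolding matched_pair_def using A H_hopf by blast
qed

end

section \<open>Rescaling the skew-primitive generator\<close>

context taft
begin

text \<open>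
  Replacing \<open>x\<close> by \<open>\<omega> x\<close> respects the three relations, which are homogeneous in \<open>x\<close>.
\<close>

lemma ex_rescale:
  "\<exists>F. klinear F \<and> F \<one>\<^sub>T = \<one>\<^sub>T \<and> (\<forall>z. F (h \<cdot> z) = h \<cdot> F z) \<and> (\<forall>z. F (x \<cdot> z) = scal \<omega> (x \<cdot> F z))"
proof (rule taft_universal)
  show "klinear (\<lambda>z. h \<cdot> z)" "klinear (\<lambda>z. scal \<omega> (x \<cdot> z))" by (intro mul_klinear_intros)+
  show "((\<lambda>z. h \<cdot> z) ^^ m) v = v" for v by (simp add: funpow_mul h_power_m)
  have "((\<lambda>z. scal \<omega> (x \<cdot> z)) ^^ l) v = scal (\<omega> ^ l) (hpow T x l \<cdot> v)" for l v
    by (induction l) (simp_all add: mul_assoc mult.commute)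
  then show "((\<lambda>z. scal \<omega> (x \<cdot> z)) ^^ m) v = 0" for v by (simp add: x_power_m)
  show "scal \<omega> (x \<cdot> (h \<cdot> v)) = scal q (h \<cdot> scal \<omega> (x \<cdot> v))" for v
    by (simp add: mul_assoc[symmetric] x_mul_h mult.commute)
qed

definition rescale :: "'k \<Rightarrow> ('t \<Rightarrow>\<^sub>0 'k) \<Rightarrow> ('t \<Rightarrow>\<^sub>0 'k)"
  where "rescale \<omega> = (SOME F. klinear F \<and> F \<one>\<^sub>T = \<one>\<^sub>T \<and> (\<forall>z. F (h \<cdot> z) = h \<cdot> F z) \<and>
    (\<forall>z. F (x \<cdot> z) = scal \<omega> (x \<cdot> F z)))"

lemma klinear_rescale: "klinear (rescale \<omega>)"
  and rescale_one: "rescale \<omega> \<one>\<^sub>T = \<one>\<^sub>T"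
  and rescale_h_mul: "rescale \<omega> (h \<cdot> z) = h \<cdot> rescale \<omega> z"
  and rescale_x_mul: "rescale \<omega> (x \<cdot> z) = scal \<omega> (x \<cdot> rescale \<omega> z)"
  using someI_ex[OF ex_rescale, of \<omega>] unfolding rescale_def by blast+

lemma rescale_scal: "rescale \<omega> (scal r z) = scal r (rescale \<omega> z)"
  using klinear_rescale by (simp add: klinear_iff)

lemma rescale_x: "rescale \<omega> x = scal \<omega> x"
  using rescale_x_mul[of \<omega> "\<one>\<^sub>T"] by (simp add: rescale_one)

lemma rescale_monomial: "rescale \<omega> (monomial i j) = scal (\<omega> ^ j) (monomial i j)"
proof -
  have "rescale \<omega> (hpow T x j) = scal (\<omega> ^ j) (hpow T x j)"
    by (induction j) (simp_all add: rescale_one rescale_x_mul mult.commute)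
  then show ?thesis
    by (induction i) (simp_all add: monomial_x_power rescale_h_mul h_mul_monomial[symmetric])
qed

lemma rescale_rescale: "rescale \<omega> (rescale \<omega>' z) = rescale (\<omega> * \<omega>') z"
  by (rule klinear_eq_taft[of "\<lambda>z. rescale \<omega> (rescale \<omega>' z)"])
     (simp_all add: klinear_rescale klinear_comp[OF klinear_rescale] rescale_one rescale_h_mul
       rescale_x_mul rescale_scal mult.commute)

lemma rescale_1: "rescale 1 z = z"
  by (rule klinear_eq_taft[of "rescale 1" "\<lambda>z. z"])
     (simp_all add: klinear_rescale klinear_ident rescale_one rescale_h_mul rescale_x_mul)

lemma counit_scal: "counit T (scal r z) = r * counit T z"
  using counit_linear[OF hopf] by (simp add: klinear_form_iff)

lemma counit_eq_on_taft:
  assumes "klinear f" "counit T (f \<one>\<^sub>T) = 1"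
    "\<And>z. counit T (f z) = counit T z \<Longrightarrow> counit T (f (h \<cdot> z)) = counit T z"
    "\<And>z. counit T (f (x \<cdot> z)) = 0"
  shows "counit T (f z) = counit T z"
proof -
  have "kvec.subspace {z. counit T (f z) = counit T z}"
    using assms(1) counit_linear[OF hopf] klinear_zero[OF assms(1)]
    by (simp add: kvec.subspace_def klinear_iff klinear_form_iff)
  then show ?thesis
    using taft_induct[of "{z. counit T (f z) = counit T z}" z] assms
    by (simp add: counit_hone[OF hopf] counit_hmul[OF hopf] counit_h counit_x)
qed

text \<open>
  Compatibility with product, coproduct and counit are equations between linear maps that hold at 1
  and are inherited from \<open>z\<close> by \<open>h z\<close> and \<open>x z\<close>; for the comultiplication because both terms of \<open>\<Delta> x\<close> are of degree 1 in \<open>x\<close>.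
\<close>

lemma bialgebra_endo_rescale: "bialgebra_endo T (rescale \<omega>)"
  unfolding bialgebra_endo_def
proof (intro conjI allI)
  let ?r = "rescale \<omega>"
  note lins = mul_klinear_intros klinear_comp[OF klinear_rescale] klinear_comult[OF hopf]
  show "klinear ?r" by (rule klinear_rescale)
  show "?r \<one>\<^sub>T = \<one>\<^sub>T" by (rule rescale_one)
  show "?r (y \<cdot> z) = ?r y \<cdot> ?r z" for y z
  proof (rule klinear_eq_taft[of "\<lambda>y. ?r (y \<cdot> z)" "\<lambda>y. ?r y \<cdot> ?r z"])
    show "klinear (\<lambda>y. ?r (y \<cdot> z))" "klinear (\<lambda>y. ?r y \<cdot> ?r z)" by (intro lins)+
  qed (simp_all add: rescale_one rescale_h_mul rescale_x_mul mul_assoc)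
  show "counit T (?r z) = counit T z" for z
    by (rule counit_eq_on_taft[OF klinear_rescale])
       (simp_all add: rescale_one counit_hone[OF hopf] counit_hmul[OF hopf] counit_h counit_x
         rescale_h_mul rescale_x_mul counit_scal)
  show "comult T (?r z) = tlift (\<lambda>z1 z2. ?r z1 \<otimes>\<^sub>K ?r z2) (comult T z)" for z
  proof (rule klinear_eq_taft[of "\<lambda>z. comult T (?r z)"])
    show "klinear (\<lambda>z. comult T (?r z))" "klinear (\<lambda>z. tlift (\<lambda>z1 z2. ?r z1 \<otimes>\<^sub>K ?r z2) (comult T z))"
      by (intro lins)+
    have rr: "tlift (\<lambda>z1 z2. ?r z1 \<otimes>\<^sub>K ?r z2) (v \<otimes>\<^sub>K w) = ?r v \<otimes>\<^sub>K ?r w" for v w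
      by (rule tlift_tensor) (intro lins)+
    show "comult T (?r \<one>\<^sub>T) = tlift (\<lambda>z1 z2. ?r z1 \<otimes>\<^sub>K ?r z2) (comult T \<one>\<^sub>T)"
      by (simp add: rescale_one comult_hone[OF hopf] rr)
    have rr_tlift: "tlift (\<lambda>z1 z2. ?r z1 \<otimes>\<^sub>K ?r z2) (tlift (\<lambda>a b. f a b \<otimes>\<^sub>K f' a b) t) =
        tlift (\<lambda>a b. ?r (f a b) \<otimes>\<^sub>K ?r (f' a b)) t"
      for f f' :: "('i \<Rightarrow>\<^sub>0 'k) \<Rightarrow> ('j \<Rightarrow>\<^sub>0 'k) \<Rightarrow> ('t \<Rightarrow>\<^sub>0 'k)" and t
      by (rule tlift_tlift_tensor) (intro lins)+
    fix z assume IH: "comult T (?r z) = tlift (\<lambda>z1 z2. ?r z1 \<otimes>\<^sub>K ?r z2) (comult T z)"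
    have hh: "tlift (\<lambda>b1 b2. h \<cdot> b1 \<otimes>\<^sub>K h \<cdot> b2) (comult T (?r z)) =
        tlift (\<lambda>b1 b2. h \<cdot> ?r b1 \<otimes>\<^sub>K h \<cdot> ?r b2) (comult T z)"
      unfolding IH by (rule tlift_tlift_tensor) (intro lins)+
    have xh: "tlift (\<lambda>b1 b2. x \<cdot> b1 \<otimes>\<^sub>K h \<cdot> b2) (comult T (?r z)) =
        tlift (\<lambda>b1 b2. x \<cdot> ?r b1 \<otimes>\<^sub>K h \<cdot> ?r b2) (comult T z)"
      unfolding IH by (rule tlift_tlift_tensor) (intro lins)+
    have x: "tlift (\<lambda>b1 b2. b1 \<otimes>\<^sub>K x \<cdot> b2) (comult T (?r z)) =
        tlift (\<lambda>b1 b2. ?r b1 \<otimes>\<^sub>K x \<cdot> ?r b2) (comult T z)"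
      unfolding IH by (rule tlift_tlift_tensor) (intro lins)+
    show "comult T (?r (h \<cdot> z)) = tlift (\<lambda>z1 z2. ?r z1 \<otimes>\<^sub>K ?r z2) (comult T (h \<cdot> z))"
      by (simp add: rescale_h_mul comult_h_mul hh rr_tlift)
    have "comult T (?r (x \<cdot> z)) = scal \<omega> (tlift (\<lambda>b1 b2. x \<cdot> ?r b1 \<otimes>\<^sub>K h \<cdot> ?r b2) (comult T z))
        + scal \<omega> (tlift (\<lambda>b1 b2. ?r b1 \<otimes>\<^sub>K x \<cdot> ?r b2) (comult T z))"
      using comult_linear[OF hopf]
      by (simp add: klinear_iff rescale_x_mul comult_x_mul xh x kvec.scale_right_distrib)
    also have "\<dots> = tlift (\<lambda>z1 z2. ?r z1 \<otimes>\<^sub>K ?r z2) (comult T (x \<cdot> z))"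
      unfolding comult_x_mul tlift_add rr_tlift
      by (simp add: rescale_x_mul rescale_h_mul tensor_scal_left tensor_scal_right
          klinear_of_tlift[OF klinear_scal[OF klinear_ident]])
    finally show "comult T (?r (x \<cdot> z)) = tlift (\<lambda>z1 z2. ?r z1 \<otimes>\<^sub>K ?r z2) (comult T (x \<cdot> z))" .
  qed
qed

lemma bialgebra_endo_eq_rescale:
  assumes \<phi>: "bialgebra_endo T \<phi>" and "\<phi> h = h" "\<phi> x = scal \<alpha> x"
  shows "\<phi> z = rescale \<alpha> z"
  by (rule klinear_eq_taft[of \<phi> "rescale \<alpha>"])
     (use assms in \<open>simp_all add: bialgebra_endo_def klinear_rescale rescale_one rescale_h_mul rescale_x_mul\<close>)

lemma bialgebra_auto_is_rescale:
  assumes "bialgebra_endo T \<phi>" "inj \<phi>"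
  shows "\<exists>\<alpha>. \<forall>z. \<phi> z = rescale \<alpha> z"
  using bialgebra_endo_form[OF assms] bialgebra_endo_eq_rescale[OF assms(1)] by blast

lemma rescale_inj: "rescale \<omega> = rescale \<omega>' \<Longrightarrow> \<omega> = \<omega>'"
proof -
  assume "rescale \<omega> = rescale \<omega>'"
  then have "scal \<omega> x = scal \<omega>' x" by (metis rescale_x)
  then show ?thesis using x_nonzero by simp
qed

end

section \<open>Matched pairs of a Taft algebra and a group Hopf algebra\<close>

locale taft_group = taft m q T h x + group_hopf G KC u
  for m :: nat and q :: "'k::field" and T :: "('t, 'k) hopf" and h x :: "'t \<Rightarrow>\<^sub>0 'k"
    and G :: "('g, 'w) monoid_scheme" (structure)
    and KC :: "('c, 'k) hopf" and u :: "'g \<Rightarrow> ('c \<Rightarrow>\<^sub>0 'k)"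
begin

text \<open>
  The compatibility axiom at \<open>a\<close> and \<open>x\<close> forces the right action to be trivial, because \<open>a \<triangleright> x\<close> cannot be a
  multiple of \<open>a \<triangleright> (h - 1)\<close>. Once it is trivial, \<open>a\<close> acts on the left by an injective
  bialgebra endomorphism.
\<close>

lemma matched_pair_form:
  assumes mp: "matched_pair T KC R L" and a: "a \<in> carrier G"
  shows "R (u a \<otimes>\<^sub>K z) = scal (counit T z) (u a)"
    and "\<exists>\<alpha>. \<forall>z. L (u a \<otimes>\<^sub>K z) = rescale \<alpha> z"
proof -
  have R: "klinear R" and L: "klinear L"
    and L_coalg: "coalgebra_map (tensor_coalg KC T) T L"
    and L_act: "\<And>y y' z. L (hmul KC y y' \<otimes>\<^sub>K z) = L (y \<otimes>\<^sub>K L (y' \<otimes>\<^sub>K z))"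
    and L_one: "\<And>z. L (hone KC \<otimes>\<^sub>K z) = z"
    and R_act: "\<And>y z w. R (y \<otimes>\<^sub>K (z \<cdot> w)) = R (R (y \<otimes>\<^sub>K z) \<otimes>\<^sub>K w)"
    and R_one: "\<And>y. R (y \<otimes>\<^sub>K \<one>\<^sub>T) = y"
    and L_unit: "\<And>y. L (y \<otimes>\<^sub>K \<one>\<^sub>T) = scal (counit KC y) \<one>\<^sub>T"
    and L_mult: "\<And>y z w. L (y \<otimes>\<^sub>K (z \<cdot> w)) =
       tlift (\<lambda>y1 y2. tlift (\<lambda>a1 a2. L (y1 \<otimes>\<^sub>K a1) \<cdot> L (R (y2 \<otimes>\<^sub>K a2) \<otimes>\<^sub>K w)) (comult T z)) (comult KC y)"
    and compat: "\<And>y z.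
       tlift (\<lambda>y1 y2. tlift (\<lambda>a1 a2. R (y1 \<otimes>\<^sub>K a1) \<otimes>\<^sub>K L (y2 \<otimes>\<^sub>K a2)) (comult T z)) (comult KC y) =
       tlift (\<lambda>y1 y2. tlift (\<lambda>a1 a2. R (y2 \<otimes>\<^sub>K a2) \<otimes>\<^sub>K L (y1 \<otimes>\<^sub>K a1)) (comult T z)) (comult KC y)"
    using mp unfolding matched_pair_def left_module_action_def right_module_action_def
      coalgebra_map_def by blast+
  note lins = mul_klinear_intros klinear_comp[OF L] klinear_comp[OF R] klinear_comult[OF hopf]
    klinear_comult[OF H_hopf] klinear_scal_form[OF counit_linear[OF hopf]]
  define l where "l z = L (u a \<otimes>\<^sub>K z)" for z
  define r where "r z = R (u a \<otimes>\<^sub>K z)" for z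
  have lin: "klinear l" "klinear r"
    unfolding l_def r_def by (intro lins)+
  have l_inverse: "L (u (inv a) \<otimes>\<^sub>K l z) = z" for z
    using a by (simp add: l_def L_act[symmetric] u_mult u_one[symmetric] L_one)
  have l_inj: "inj l"
    by (rule inj_on_inverseI[of _ "\<lambda>z. L (u (inv a) \<otimes>\<^sub>K z)"]) (simp add: l_inverse)
  have l_one: "l \<one>\<^sub>T = \<one>\<^sub>T" and r_one: "r \<one>\<^sub>T = u a"
    by (simp_all add: l_def r_def L_unit R_one counit_u[OF a])
  have cross: "tlift (\<lambda>a1 a2. r a1 \<otimes>\<^sub>K l a2) (comult T x) = tlift (\<lambda>a1 a2. r a2 \<otimes>\<^sub>K l a1) (comult T x)"
  proof -
    have "tlift (\<lambda>y1 y2. tlift (\<lambda>a1 a2. R (y1 \<otimes>\<^sub>K a1) \<otimes>\<^sub>K L (y2 \<otimes>\<^sub>K a2)) (comult T x)) (comult KC (u a)) =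
        tlift (\<lambda>a1 a2. r a1 \<otimes>\<^sub>K l a2) (comult T x)"
      unfolding l_def r_def by (rule tlift_comult_u[OF a]) (intro lins)+
    moreover have "tlift (\<lambda>y1 y2. tlift (\<lambda>a1 a2. R (y2 \<otimes>\<^sub>K a2) \<otimes>\<^sub>K L (y1 \<otimes>\<^sub>K a1)) (comult T x)) (comult KC (u a)) =
        tlift (\<lambda>a1 a2. r a2 \<otimes>\<^sub>K l a1) (comult T x)"
      unfolding l_def r_def by (rule tlift_comult_u[OF a]) (intro lins)+
    ultimately show ?thesis using compat[of x "u a"] by simp
  qed
  have "tlift (\<lambda>a1 a2. r a1 \<otimes>\<^sub>K l a2) (v \<otimes>\<^sub>K w) = r v \<otimes>\<^sub>K l w"
    and "tlift (\<lambda>a1 a2. r a2 \<otimes>\<^sub>K l a1) (v \<otimes>\<^sub>K w) = r w \<otimes>\<^sub>K l v" for v w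
    by (rule tlift_tensor; intro klinear_tensor_left klinear_tensor_right lin)+
  with cross have "r x \<otimes>\<^sub>K l h + u a \<otimes>\<^sub>K l x = r h \<otimes>\<^sub>K l x + r x \<otimes>\<^sub>K \<one>\<^sub>T"
    by (simp add: comult_x tlift_add r_one l_one)
  then have cross': "(r h - u a) \<otimes>\<^sub>K l x = r x \<otimes>\<^sub>K (l h - \<one>\<^sub>T)"
    by (simp add: tensor_diff_left tensor_diff_right algebra_simps)
  have r_h: "r h = u a"
  proof (rule ccontr)
    assume "r h \<noteq> u a"
    then obtain d where "l x = scal d (l h - \<one>\<^sub>T)"
      using tensor_proportional[OF cross'] by auto
    also have "\<dots> = l (scal d (h - \<one>\<^sub>T))"
      using lin(1) by (simp add: klinear_iff klinear_diff[OF lin(1)] l_one)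
    finally have "x = scal d (h - \<one>\<^sub>T)"
      using l_inj by (simp add: inj_eq)
    then have "cf 0 1 x = cf 0 1 (scal d (h - \<one>\<^sub>T))"
      by (rule arg_cong)
    moreover have "cf 0 1 x = 1" "cf 0 1 h = 0" "cf 0 1 \<one>\<^sub>T = 0"
      using m_ge_2 cf_monomial[of 0 1 0 1, unfolded monomial_0_1]
        cf_monomial[of 1 0 0 1, unfolded monomial_1_0] cf_monomial[of 0 0 0 1, unfolded monomial_0_0]
      by simp_all
    ultimately show False by (simp add: cf_linear)
  qed
  have "h \<noteq> \<one>\<^sub>T"
    using cf_monomial[of 1 0 0 0, unfolded monomial_1_0] cf_monomial[of 0 0 0 0, unfolded monomial_0_0]
      m_ge_2 by auto
  then have "l h - \<one>\<^sub>T \<noteq> 0"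
    using l_inj l_one by (metis injD right_minus_eq)
  then have r_x: "r x = 0"
    using cross' by (simp add: r_h tensor_eq_zero)
  have r: "r z = scal (counit T z) (u a)" for z
  proof (rule klinear_eq_taft[of r "\<lambda>z. scal (counit T z) (u a)"])
    show "klinear r" by (rule lin)
    show "klinear (\<lambda>z. scal (counit T z) (u a))" by (intro lins)
    fix z assume IH: "r z = scal (counit T z) (u a)"
    have "r (h \<cdot> z) = r z" by (simp add: r_def R_act) (simp add: r_def[symmetric] r_h)
    then show "r (h \<cdot> z) = scal (counit T (h \<cdot> z)) (u a)"
      by (simp add: IH counit_hmul[OF hopf] counit_h)
    have "r (x \<cdot> z) = 0"
      by (simp add: r_def R_act) (simp add: r_def[symmetric] r_x klinear_zero[OF R])
    then show "r (x \<cdot> z) = scal (counit T (x \<cdot> z)) (u a)"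
      by (simp add: counit_hmul[OF hopf] counit_x)
  qed (simp add: r_one counit_hone[OF hopf])
  then show "R (u a \<otimes>\<^sub>K z) = scal (counit T z) (u a)" by (simp add: r_def)
  have l_mult: "l (z \<cdot> w) = l z \<cdot> l w" for z w
  proof -
    have "l (z \<cdot> w) = tlift (\<lambda>a1 a2. L (u a \<otimes>\<^sub>K a1) \<cdot> L (R (u a \<otimes>\<^sub>K a2) \<otimes>\<^sub>K w)) (comult T z)"
      unfolding l_def L_mult by (rule tlift_comult_u[OF a]) (intro lins)+
    also have "\<dots> = tlift (\<lambda>a1 a2. l (scal (counit T a2) a1) \<cdot> l w) (comult T z)"
      using r lin(1) L by (simp add: l_def r_def tensor_scal_left tensor_scal_right klinear_iff)
    also have "\<dots> = l (tlift (\<lambda>a1 a2. scal (counit T a2) a1) (comult T z)) \<cdot> l w"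
      by (rule klinear_of_tlift[symmetric]) (intro lins klinear_comp[OF lin(1)])
    finally show ?thesis by (simp add: counit_right[OF hopf])
  qed
  have "bialgebra_endo T l"
    unfolding bialgebra_endo_def
    using lin(1) l_one l_mult L_coalg[unfolded coalgebra_map_iff[OF hopf hopf]] a
    by (simp add: l_def)
  from bialgebra_auto_is_rescale[OF this l_inj]
  show "\<exists>\<alpha>. \<forall>z. L (u a \<otimes>\<^sub>K z) = rescale \<alpha> z" by (simp add: l_def)
qed

end

locale taft_cyclic = taft_group m q T h x G KC u
  for m :: nat and q :: "'k::field" and T :: "('t, 'k) hopf" and h x :: "'t \<Rightarrow>\<^sub>0 'k"
    and G :: "('g, 'w) monoid_scheme" (structure)
    and KC :: "('c, 'k) hopf" and u :: "'g \<Rightarrow> ('c \<Rightarrow>\<^sub>0 'k)" +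
  fixes n :: nat and c :: 'g
  assumes order_n: "order G = n" and n_pos: "n > 0"
    and c_carrier: "c \<in> carrier G" and c_generates: "carrier G = generate G {c}"
begin

lemma carrier_powers: "carrier G = {c [^] i | i :: nat. True}"
proof -
  have "finite (carrier G)"
    using order_n n_pos by (simp add: order_gt_0_iff_finite[symmetric])
  then show ?thesis
    using generate_pow_on_finite_carrier[OF _ c_carrier] c_generates by auto
qed

text \<open>
  The order of \<open>c\<close> is \<open>n\<close>, so for an \<open>n\<close>-th root of unity \<open>\<omega>\<close> the assignment \<open>c\<^sup>i \<mapsto> \<omega>\<^sup>i\<close> is a
  well-defined character of the group.
\<close>

lemma c_power_eq_imp:
  assumes "c [^] i = c [^] j" "\<omega> \<in> roots_of_unity n"
  shows "\<omega> ^ i = (\<omega> ^ j :: 'k)"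
proof -
  have *: "\<omega> ^ i = \<omega> ^ j" if "i \<le> j" "c [^] i = c [^] j" for i j :: nat
  proof -
    have "c [^] i \<otimes> c [^] (j - i) = c [^] i \<otimes> \<one>"
      using that c_carrier nat_pow_mult[OF c_carrier, of i "j - i"] by simp
    then have "c [^] (j - i) = \<one>"
      using c_carrier by simp
    moreover have "ord c = n"
      by (metis generate_pow_card[OF c_carrier] order_n order_def c_generates)
    ultimately have "n dvd j - i"
      using pow_eq_id[OF c_carrier, of "j - i"] by (simp only:)
    then obtain k where "j - i = n * k"
      by (rule dvdE)
    then have "j = i + n * k"
      using that(1) by simp
    then show ?thesis
      using assms(2) by (simp add: roots_of_unity_def power_add power_mult)
  qed
  show ?thesis
  proof (cases "i \<le> j")
    case True
    then show ?thesis by (rule *[OF _ assms(1)])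
  next
    case False
    then have "j \<le> i" by simp
    then show ?thesis by (rule *[OF _ assms(1)[symmetric], symmetric])
  qed
qed

text \<open>
  The graph of the bijection between roots of unity and matched pairs.
\<close>

definition parametrizes :: "'k \<Rightarrow> (('c \<times> 't \<Rightarrow>\<^sub>0 'k) \<Rightarrow> ('c \<Rightarrow>\<^sub>0 'k)) \<times> (('c \<times> 't \<Rightarrow>\<^sub>0 'k) \<Rightarrow> ('t \<Rightarrow>\<^sub>0 'k)) \<Rightarrow> bool"
  where "parametrizes \<omega> p \<longleftrightarrow> matched_pair T KC (fst p) (snd p) \<and>
    (\<forall>z. snd p (u c \<otimes>\<^sub>K z) = rescale \<omega> z)"

lemma parametrizes_power:
  assumes "parametrizes \<omega> (R, L)"
  shows "L (u (c [^] i) \<otimes>\<^sub>K z) = rescale (\<omega> ^ i) z"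
proof -
  have act: "L (hmul KC y y' \<otimes>\<^sub>K z) = L (y \<otimes>\<^sub>K L (y' \<otimes>\<^sub>K z))" "L (hone KC \<otimes>\<^sub>K z) = z" for y y' z
    using assms by (auto simp: parametrizes_def matched_pair_def left_module_action_def)
  have c: "L (u c \<otimes>\<^sub>K z) = rescale \<omega> z" for z
    using assms by (simp add: parametrizes_def)
  show ?thesis
  proof (induction i)
    case 0
    show ?case by (simp add: u_one[symmetric] act rescale_1)
  next
    case (Suc i)
    have "u (c [^] Suc i) = hmul KC (u c) (u (c [^] i))"
      using c_carrier by (simp only: u_mult nat_pow_closed nat_pow_Suc2)
    then show ?case by (simp add: act Suc c rescale_rescale)
  qed
qed

text \<open>
  The group acts through the character \<open>c\<^sup>i \<mapsto> \<omega>\<^sup>i\<close>, computed from a chosen exponent of each group element.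
\<close>

lemma parametrizes_exists:
  assumes "\<omega> \<in> roots_of_unity n"
  shows "\<exists>p. parametrizes \<omega> p"
proof -
  define e where "e a = (SOME i. a = c [^] (i :: nat))" for a
  have e: "a = c [^] e a" if "a \<in> carrier G" for a
    unfolding e_def by (rule someI_ex) (use that carrier_powers in blast)
  have \<omega>_e: "\<omega> ^ e a = \<omega> ^ i" if "a = c [^] i" for a i
    by (rule c_power_eq_imp[OF _ assms]) (use that e c_carrier in simp)
  have e_mult: "\<omega> ^ e (a \<otimes> b) = \<omega> ^ e a * \<omega> ^ e b" if "a \<in> carrier G" "b \<in> carrier G" for a b
  proof -
    have "a \<otimes> b = c [^] (e a + e b)"
      using e[OF that(1)] e[OF that(2)] c_carrier by (simp add: nat_pow_mult[symmetric])
    then show ?thesis by (simp add: \<omega>_e power_add)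
  qed
  obtain L where L: "klinear L" "\<forall>a\<in>carrier G. \<forall>z. L (u a \<otimes>\<^sub>K z) = rescale (\<omega> ^ e a) z"
    using ex_linear_on_group_tensors[of "\<lambda>a. rescale (\<omega> ^ e a)"] klinear_rescale by blast
  define R :: "('c \<times> 't \<Rightarrow>\<^sub>0 'k) \<Rightarrow> ('c \<Rightarrow>\<^sub>0 'k)" where "R = tlift (\<lambda>y z. scal (counit T z) y)"
  have R_tensor: "R (y \<otimes>\<^sub>K z) = scal (counit T z) y" for y z
    unfolding R_def
    by (rule tlift_tensor) (intro klinear_intros klinear_scal_form[OF counit_linear[OF hopf]])+
  have R: "klinear R" unfolding R_def by (rule klinear_tlift[OF klinear_ident])
  have "matched_pair T KC R L"
  proof (rule matched_pair_trivial_right[where \<phi> = "\<lambda>a. rescale (\<omega> ^ e a)"])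
    show "rescale (\<omega> ^ e \<one>) z = z" for z
      using \<omega>_e[of \<one> 0] by (simp add: rescale_1)
  qed (use L R R_tensor in \<open>simp_all add: hopf bialgebra_endo_rescale e_mult rescale_rescale\<close>)
  moreover have "L (u c \<otimes>\<^sub>K z) = rescale \<omega> z" for z
    using L(2) c_carrier \<omega>_e[of c 1] by simp
  ultimately show ?thesis by (intro exI[of _ "(R, L)"]) (simp add: parametrizes_def)
qed

lemma parametrizes_right_unique:
  assumes "parametrizes \<omega> p" "parametrizes \<omega> p'"
  shows "p = p'"
proof -
  obtain R L R' L' where p: "p = (R, L)" "p' = (R', L')" by fastforce
  have mp: "matched_pair T KC R L" "matched_pair T KC R' L'"
    using assms by (auto simp: p parametrizes_def)
  have lin: "klinear R" "klinear R'" "klinear L" "klinear L'"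
    using mp by (auto simp: matched_pair_def coalgebra_map_def)
  have "R t = R' t" for t
    by (rule klinear_eq_on_group_tensors[OF lin(1,2)]) (simp add: mp[THEN matched_pair_form(1)])
  moreover have "L t = L' t" for t
    by (rule klinear_eq_on_group_tensors[OF lin(3,4)])
       (use carrier_powers parametrizes_power[OF assms(1)[unfolded p]]
          parametrizes_power[OF assms(2)[unfolded p]] in force)
  ultimately show ?thesis by (simp add: p fun_eq_iff)
qed

lemma matched_pair_parametrized:
  assumes "matched_pair T KC R L"
  shows "\<exists>\<omega>\<in>roots_of_unity n. parametrizes \<omega> (R, L)"
proof -
  obtain \<omega> where "\<forall>z. L (u c \<otimes>\<^sub>K z) = rescale \<omega> z"
    using matched_pair_form(2)[OF assms c_carrier] by blast
  with assms have \<omega>: "parametrizes \<omega> (R, L)" by (simp add: parametrizes_def)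
  have "rescale (\<omega> ^ n) z = rescale 1 z" for z
    using parametrizes_power[OF \<omega>, of n z] parametrizes_power[OF \<omega>, of 0 z]
      pow_order_eq_1[OF c_carrier] order_n by simp
  then have "\<omega> ^ n = 1" using rescale_inj by blast
  then show ?thesis using \<omega> by (auto simp: roots_of_unity_def)
qed

lemma parametrizes_formula:
  assumes "parametrizes \<omega> (R, L)"
  shows "L (hpow KC (u c) i \<otimes>\<^sub>K monomial j k) = scal (\<omega> ^ (i * k)) (monomial j k)"
    and "R (hpow KC (u c) i \<otimes>\<^sub>K monomial j k) = scal (counit T (hpow T x k)) (hpow KC (u c) i)"
proof -
  have g: "hpow KC (u c) i = u (c [^] i)"
  proof (induction i)
    case 0
    show ?case by (simp add: u_one)
  next
    case (Suc i)
    then show ?case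
      using c_carrier by (simp only: hpow.simps u_mult nat_pow_closed nat_pow_Suc2)
  qed
  show "L (hpow KC (u c) i \<otimes>\<^sub>K monomial j k) = scal (\<omega> ^ (i * k)) (monomial j k)"
    by (simp add: g parametrizes_power[OF assms] rescale_monomial power_mult)
  have "matched_pair T KC R L" using assms by (simp add: parametrizes_def)
  then show "R (hpow KC (u c) i \<otimes>\<^sub>K monomial j k) = scal (counit T (hpow T x k)) (hpow KC (u c) i)"
    using c_carrier
    by (simp add: g matched_pair_form(1) monomial_def counit_hmul[OF hopf] counit_h_power)
qed

end

theorem proposition3p1:
  fixes m n :: nat
    and q :: "'k::field"
    and T :: "('t, 'k) hopf" and h x :: "'t \<Rightarrow>\<^sub>0 'k"
    and C :: "('g, 'w) monoid_scheme" and c :: 'g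
    and KC :: "('c, 'k) hopf" and u :: "'g \<Rightarrow> ('c \<Rightarrow>\<^sub>0 'k)" and g :: "'c \<Rightarrow>\<^sub>0 'k"
  assumes "m \<ge> 3" and "n \<ge> 2"
    and "primitive_root_of_unity m q"
    and "taft_algebra m q T h x"
    and "group C" and "order C = n" and "c \<in> carrier C" and "carrier C = generate C {c}"
    and "group_hopf_algebra C KC u" and "g = u c"
  shows "\<exists>\<Phi>. bij_betw \<Phi> (roots_of_unity n :: 'k set)
                 {(ract, lact). matched_pair T KC ract lact} \<and>
           (\<forall>\<omega>\<in>roots_of_unity n. \<forall>ract lact. \<Phi> \<omega> = (ract, lact) \<longrightarrow>
              (\<forall>i<n. \<forall>j<m. \<forall>k<m.
                 lact (hpow KC g i \<otimes>\<^sub>K hmul T (hpow T h j) (hpow T x k)) =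
                   scal (\<omega> ^ (i * k)) (hmul T (hpow T h j) (hpow T x k)) \<and>
                 ract (hpow KC g i \<otimes>\<^sub>K hmul T (hpow T h j) (hpow T x k)) =
                   scal (counit T (hpow T x k)) (hpow KC g i)))"
proof -
  interpret taft_cyclic m q T h x C KC u n c
    by unfold_locales (use assms in auto)
  define \<Phi> where "\<Phi> \<omega> = (SOME p. parametrizes \<omega> p)" for \<omega>
  have \<Phi>: "parametrizes \<omega> (\<Phi> \<omega>)" if "\<omega> \<in> roots_of_unity n" for \<omega>
    unfolding \<Phi>_def using someI_ex[OF parametrizes_exists[OF that]] .
  have "bij_betw \<Phi> (roots_of_unity n) {(ract, lact). matched_pair T KC ract lact}"
    unfolding bij_betw_def
  proof
    show "inj_on \<Phi> (roots_of_unity n)"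
    proof (rule inj_onI)
      fix \<omega> \<omega>' :: 'k assume "\<omega> \<in> roots_of_unity n" "\<omega>' \<in> roots_of_unity n" "\<Phi> \<omega> = \<Phi> \<omega>'"
      then have "parametrizes \<omega> (\<Phi> \<omega>)" "parametrizes \<omega>' (\<Phi> \<omega>)" using \<Phi> by metis+
      then have "rescale \<omega> = rescale \<omega>'" by (simp add: parametrizes_def fun_eq_iff)
      then show "\<omega> = \<omega>'" by (rule rescale_inj)
    qed
    show "\<Phi> ` roots_of_unity n = {(ract, lact). matched_pair T KC ract lact}"
    proof (intro subset_antisym subsetI)
      fix p assume "p \<in> \<Phi> ` roots_of_unity n"
      then show "p \<in> {(ract, lact). matched_pair T KC ract lact}"
        using \<Phi> by (auto simp: parametrizes_def case_prod_beta)
    next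
      fix p assume "p \<in> {(ract, lact). matched_pair T KC ract lact}"
      then obtain \<omega> where "\<omega> \<in> roots_of_unity n" "parametrizes \<omega> p"
        using matched_pair_parametrized by (cases p) auto
      then show "p \<in> \<Phi> ` roots_of_unity n"
        using parametrizes_right_unique[OF _ \<Phi>] by blast
    qed
  qed
  moreover have "lact (hpow KC g i \<otimes>\<^sub>K hmul T (hpow T h j) (hpow T x k)) =
        scal (\<omega> ^ (i * k)) (hmul T (hpow T h j) (hpow T x k)) \<and>
      ract (hpow KC g i \<otimes>\<^sub>K hmul T (hpow T h j) (hpow T x k)) =
        scal (counit T (hpow T x k)) (hpow KC g i)"
    if "\<omega> \<in> roots_of_unity n" "\<Phi> \<omega> = (ract, lact)" for \<omega> ract lact i j k
    using parametrizes_formula[of \<omega> ract lact i j k] \<Phi>[OF that(1)] that(2)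
    by (simp add: monomial_def assms(10))
  ultimately show ?thesis by blast
qed

end
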